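(* Let $\beta\in\{1,2,4\}$, $N\ge1$ and $\omega_1,\dots,\omega_N>0$. Let $X$ be a random $N\times N$ matrix with real ($\beta=1$), complex ($\beta=2$) or quaternion ($\beta=4$) entries, with independent rows, the $l$-th row having the beta type II density $$\pi^{-\beta N/2}(\omega_l/2)_{\beta N/2}(1+|\mathbf x|^2)^{-(\beta N+\omega_l)/2}$$ on $\mathbb R^{\beta N}$. Then the largest Lyapunov exponent $\mu_1$ of the product $P_m=X_mX_{m-1}\cdots X_1$ of independent copies $X_i$ of $X$ is given by $$2\mu_1=\int_0^\infty\bigg(e^{-t}-\prod_{l=1}^N\Big(\frac{\Gamma((\omega_l+\beta)/2)}{\Gamma(\omega_l/2)}\,U(\beta/2,\,1-\omega_l/2;\,t)\Big)\bigg)\frac{dt}t.$$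
   Context: A row $\mathbf x=(x_1,\dots,x_N)$ is identified with a vector in $\mathbb R^{\beta N}$ (each entry has $\beta$ real components), $|x_i|^2$ is the sum of the squares of the real components of $x_i$, $|\mathbf x|^2=\sum_i|x_i|^2$, and densities are with respect to Lebesgue measure. $(c)_s=\Gamma(c+s)/\Gamma(c)$. $U(a,b;t)$ is the confluent hypergeometric function of the second kind (Tricomi's function), $U(a,b;t)=\frac1{\Gamma(a)}\int_0^\infty e^{-ts}s^{a-1}(1+s)^{b-a-1}\,ds$ for $a>0$, $t>0$. The largest Lyapunov exponent is the almost surely constant quantity $\mu_1=\sup_{y\ne0}\lim_{m\to\infty}\frac1m\log\|P_my\|$, the supremum being over nonzero column vectors $y$ with entries in the corresponding number system and $\|\cdot\|$ the Euclidean norm ($\|y\|^2$ is the sum of the squares of all real components of $y$). Equivalently, by Oseledec's theorem, $e^{\mu_1}$ is the largest eigenvalue of $\lim_{m\to\infty}(P_m^\dagger P_m)^{1/2m}$. *)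

theory Defs
  imports "HOL-Probability.Probability"
begin

section \<open>The quaternions\<close>

codatatype quat = Quat (Re1: real) (Im1: real) (Im2: real) (Im3: real)

lemma quat_eqI:
  "\<lbrakk>Re1 x = Re1 y; Im1 x = Im1 y; Im2 x = Im2 y; Im3 x = Im3 y\<rbrakk> \<Longrightarrow> x = y"
  by (rule quat.expand) simp

lemma quat_eq_iff:
  "x = y \<longleftrightarrow> Re1 x = Re1 y \<and> Im1 x = Im1 y \<and> Im2 x = Im2 y \<and> Im3 x = Im3 y"
  by (auto intro: quat_eqI)

instantiation quat :: ab_group_add
begin

primcorec zero_quat where
  "Re1 0 = 0" | "Im1 0 = 0" | "Im2 0 = 0" | "Im3 0 = 0"

primcorec plus_quat where
  "Re1 (x + y) = Re1 x + Re1 y"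
| "Im1 (x + y) = Im1 x + Im1 y"
| "Im2 (x + y) = Im2 x + Im2 y"
| "Im3 (x + y) = Im3 x + Im3 y"

primcorec uminus_quat where
  "Re1 (- x) = - Re1 x"
| "Im1 (- x) = - Im1 x"
| "Im2 (- x) = - Im2 x"
| "Im3 (- x) = - Im3 x"

primcorec minus_quat where
  "Re1 (x - y) = Re1 x - Re1 y"
| "Im1 (x - y) = Im1 x - Im1 y"
| "Im2 (x - y) = Im2 x - Im2 y"
| "Im3 (x - y) = Im3 x - Im3 y"

instance
  by standard (simp_all add: quat_eq_iff)

end

instantiation quat :: ring_1
begin

primcorec one_quat where
  "Re1 1 = 1" | "Im1 1 = 0" | "Im2 1 = 0" | "Im3 1 = 0"

primcorec times_quat where
  "Re1 (x * y) = Re1 x * Re1 y - Im1 x * Im1 y - Im2 x * Im2 y - Im3 x * Im3 y"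
| "Im1 (x * y) = Re1 x * Im1 y + Im1 x * Re1 y + Im2 x * Im3 y - Im3 x * Im2 y"
| "Im2 (x * y) = Re1 x * Im2 y - Im1 x * Im3 y + Im2 x * Re1 y + Im3 x * Im1 y"
| "Im3 (x * y) = Re1 x * Im3 y + Im1 x * Im2 y - Im2 x * Im1 y + Im3 x * Re1 y"

instance
  by standard (simp_all add: quat_eq_iff algebra_simps)

end

instantiation quat :: real_algebra_1
begin

primcorec scaleR_quat where
  "Re1 (scaleR r x) = r * Re1 x"
| "Im1 (scaleR r x) = r * Im1 x"
| "Im2 (scaleR r x) = r * Im2 x"
| "Im3 (scaleR r x) = r * Im3 x"

instance
  by standard (simp_all add: quat_eq_iff algebra_simps)

end

instantiation quat :: real_div_algebra
begin

primcorec inverse_quat where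
  "Re1 (inverse x) = Re1 x / ((Re1 x)\<^sup>2 + (Im1 x)\<^sup>2 + (Im2 x)\<^sup>2 + (Im3 x)\<^sup>2)"
| "Im1 (inverse x) = - Im1 x / ((Re1 x)\<^sup>2 + (Im1 x)\<^sup>2 + (Im2 x)\<^sup>2 + (Im3 x)\<^sup>2)"
| "Im2 (inverse x) = - Im2 x / ((Re1 x)\<^sup>2 + (Im1 x)\<^sup>2 + (Im2 x)\<^sup>2 + (Im3 x)\<^sup>2)"
| "Im3 (inverse x) = - Im3 x / ((Re1 x)\<^sup>2 + (Im1 x)\<^sup>2 + (Im2 x)\<^sup>2 + (Im3 x)\<^sup>2)"

definition "x div y = x * inverse y" for x y :: quat

lemma quat_sum_squares_nz:
  assumes "x \<noteq> 0"
  shows "(Re1 x)\<^sup>2 + (Im1 x)\<^sup>2 + (Im2 x)\<^sup>2 + (Im3 x)\<^sup>2 \<noteq> 0"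
  using assms by (auto simp: quat_eq_iff add_nonneg_eq_0_iff)

instance
proof
  fix x y :: quat
  show "x div y = x * inverse y" by (simp add: divide_quat_def)
  show "inverse (0::quat) = 0" by (simp add: quat_eq_iff)
  define n where "n = (Re1 x)\<^sup>2 + (Im1 x)\<^sup>2 + (Im2 x)\<^sup>2 + (Im3 x)\<^sup>2"
  define c where "c = Quat (Re1 x) (- Im1 x) (- Im2 x) (- Im3 x)"
  assume "x \<noteq> 0"
  then have n: "n \<noteq> 0" unfolding n_def by (rule quat_sum_squares_nz)
  have inv: "inverse x = inverse n *\<^sub>R c"
    by (simp add: quat_eq_iff n_def c_def divide_inverse mult.commute)
  have "c * x = n *\<^sub>R 1"
    by (simp add: quat_eq_iff n_def c_def power2_eq_square)
  with n show "inverse x * x = 1" by (simp add: inv)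
  have "x * c = n *\<^sub>R 1"
    by (simp add: quat_eq_iff n_def c_def power2_eq_square)
  with n show "x * inverse x = 1" by (simp add: inv)
qed

end

instantiation quat :: real_inner
begin

definition inner_quat_def:
  "inner x y = Re1 x * Re1 y + Im1 x * Im1 y + Im2 x * Im2 y + Im3 x * Im3 y"

definition norm_quat_def:
  "norm (x::quat) = sqrt (inner x x)"

definition sgn_quat_def: "sgn (x::quat) = x /\<^sub>R norm x"

definition dist_quat_def: "dist (x::quat) y = norm (x - y)"

definition uniformity_quat_def [code del]:
  "(uniformity :: (quat \<times> quat) filter) = (INF e\<in>{0 <..}. principal {(x, y). dist x y < e})"

definition open_quat_def [code del]:
  "open (U :: quat set) \<longleftrightarrow> (\<forall>x\<in>U. eventually (\<lambda>(x', y). x' = x \<longrightarrow> y \<in> U) uniformity)"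

instance
proof
  fix x y z :: quat and r :: real and U :: "quat set"
  show "inner x y = inner y x"
    "inner (x + y) z = inner x z + inner y z"
    "inner (scaleR r x) y = r * inner x y"
    "0 \<le> inner x x"
    by (simp_all add: inner_quat_def algebra_simps)
  have "inner x x = (Re1 x)\<^sup>2 + (Im1 x)\<^sup>2 + (Im2 x)\<^sup>2 + (Im3 x)\<^sup>2"
    by (simp add: inner_quat_def power2_eq_square)
  then show "inner x x = 0 \<longleftrightarrow> x = 0"
    using quat_sum_squares_nz[of x] by (auto simp: inner_quat_def)
qed (rule norm_quat_def sgn_quat_def dist_quat_def uniformity_quat_def open_quat_def)+

end

instance quat :: real_normed_div_algebra
proof
  fix x y :: quat
  have "inner (x * y) (x * y) = inner x x * inner y y"
    by (simp add: inner_quat_def algebra_simps)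
  then show "norm (x * y) = norm x * norm y"
    by (simp add: norm_quat_def real_sqrt_mult)
qed

instantiation quat :: euclidean_space
begin

definition Basis_quat_def:
  "Basis = {Quat 1 0 0 0, Quat 0 1 0 0, Quat 0 0 1 0, Quat 0 0 0 1}"

instance
proof
  fix u v x :: quat
  show "(Basis :: quat set) \<noteq> {}" "finite (Basis :: quat set)"
    by (simp_all add: Basis_quat_def)
  show "(\<forall>u\<in>Basis. inner x u = 0) \<longleftrightarrow> x = 0"
    by (auto simp: Basis_quat_def inner_quat_def intro: quat_eqI)
  assume u: "u \<in> Basis" and v: "v \<in> Basis"
  show "inner u v = (if u = v then 1 else 0)"
    using u v unfolding Basis_quat_def by (elim insertE emptyE) (simp_all add: inner_quat_def)
qed

end

lemma DIM_quat [simp]: "DIM(quat) = 4"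
  by (simp add: Basis_quat_def)


section \<open>Random matrices with beta type II rows\<close>

text \<open>
  The matrices have type \<open>'a^'n^'n\<close> with \<open>'a\<close> one of real, complex, quat. A row then lives
  in \<open>'a^'n\<close>, whose norm is the Euclidean norm of its \<open>\<beta>N\<close> real components and whose
  \<open>lborel\<close> is Lebesgue measure on \<open>\<real>\<^sup>\<beta>\<^sup>N\<close>, where \<open>\<beta> = DIM('a)\<close> and \<open>N = CARD('n)\<close>.
\<close>

text \<open>The library's \<open>pochhammer\<close> only covers a natural number as second argument.\<close>

definition gen_pochhammer :: "real \<Rightarrow> real \<Rightarrow> real" where
  "gen_pochhammer c s = Gamma (c + s) / Gamma c"

definition beta_II_density :: "real \<Rightarrow> ('a::euclidean_space)^'n \<Rightarrow> real" where
  "beta_II_density \<omega> x =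
     (let d = real DIM('a) * real CARD('n)
      in pi powr (- d / 2) * gen_pochhammer (\<omega> / 2) (d / 2)
           * (1 + (norm x)\<^sup>2) powr (- (d + \<omega>) / 2))"

definition beta_II_rows ::
  "'w measure \<Rightarrow> ('n \<Rightarrow> real) \<Rightarrow> ('w \<Rightarrow> ('a::euclidean_space)^'n^'n) \<Rightarrow> bool" where
  "beta_II_rows M \<omega> X \<longleftrightarrow>
     prob_space.indep_vars M (\<lambda>_. borel) (\<lambda>l w. row l (X w)) UNIV \<and>
     (\<forall>l. distributed M lborel (\<lambda>w. row l (X w)) (\<lambda>x. ennreal (beta_II_density (\<omega> l) x)))"

definition iid_beta_II_rows ::
  "'w measure \<Rightarrow> ('n \<Rightarrow> real) \<Rightarrow> (nat \<Rightarrow> 'w \<Rightarrow> ('a::euclidean_space)^'n^'n) \<Rightarrow> bool" where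
  "iid_beta_II_rows M \<omega> X \<longleftrightarrow>
     prob_space.indep_vars M (\<lambda>_. borel) X UNIV \<and> (\<forall>i. beta_II_rows M \<omega> (X i))"


section \<open>The largest Lyapunov exponent\<close>

text \<open>
  Sequences of matrices are numbered from 0, so \<open>left_product A m\<close> is
  \<open>A (m - 1) ** \<dots> ** A 0\<close>, a product of \<open>m\<close> factors.
\<close>

primrec left_product :: "(nat \<Rightarrow> ('a::semiring_1)^'n^'n) \<Rightarrow> nat \<Rightarrow> 'a^'n^'n" where
  "left_product A 0 = mat 1"
| "left_product A (Suc m) = A m ** left_product A m"

text \<open>Since \<open>ln 0 = 0\<close> for real numbers, the convention \<open>log 0 = -\<infinity>\<close> has to be put in by hand.\<close>

definition log_norm :: "'v::real_normed_vector \<Rightarrow> ereal" where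
  "log_norm v = (if v = 0 then -\<infinity> else ereal (ln (norm v)))"

definition growth_rate ::
  "(nat \<Rightarrow> ('a::real_normed_div_algebra)^'n^'n) \<Rightarrow> 'a^'n \<Rightarrow> nat \<Rightarrow> ereal" where
  "growth_rate A y m = log_norm (left_product A m *v y) / ereal (real m)"

text \<open>
  The number \<open>\<mu>\<close> is the almost sure value of the supremum, over all nonzero \<open>y\<close>, of the limits
  of \<open>growth_rate\<close>; for each nonzero \<open>y\<close> the limit has to exist almost surely. The supremum is
  taken in the extended reals, so it cannot be finite by a convention about unbounded or empty
  sets. By Oseledec's theorem the limits almost surely exist for all \<open>y\<close> simultaneously; the
  definition does not presuppose this.
\<close>

definition is_largest_lyapunov_exponent ::
  "'w measure \<Rightarrow> (nat \<Rightarrow> 'w \<Rightarrow> ('a::real_normed_div_algebra)^'n^'n) \<Rightarrow> real \<Rightarrow> bool" where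
  "is_largest_lyapunov_exponent M X \<mu> \<longleftrightarrow>
     (\<forall>y. y \<noteq> 0 \<longrightarrow> (AE w in M. convergent (growth_rate (\<lambda>i. X i w) y))) \<and>
     (AE w in M. Sup {L. \<exists>y. y \<noteq> 0 \<and> growth_rate (\<lambda>i. X i w) y \<longlonglongrightarrow> L} = ereal \<mu>)"


section \<open>Tricomi's function\<close>

text \<open>The integral representation, valid for \<open>a > 0\<close> and \<open>t > 0\<close>.\<close>

definition tricomi_U :: "real \<Rightarrow> real \<Rightarrow> real \<Rightarrow> real" where
  "tricomi_U a b t =
     1 / Gamma a * (LBINT s:{0<..}. exp (- t * s) * s powr (a - 1) * (1 + s) powr (b - a - 1))"

end

theory Submission
  imports Defs
begin

text \<open>
  A beta type II row is a Gaussian scale mixture, so the law of \<open>|x \<cdot> v|\<^sup>2\<close> for a row \<open>x\<close> depends on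
  \<open>v\<close> only through \<open>|v|\<close>: its Laplace transform is that of \<open>|v|\<^sup>2 R\<close> with \<open>R\<close> beta prime distributed,
  and this transform is Tricomi's function. Hence \<open>|X v|\<^sup>2\<close> is distributed as \<open>|v|\<^sup>2 S\<close> with \<open>S\<close> a sum
  of independent beta prime variables, and \<open>E |P\<^sub>m y|\<^sup>2\<^sup>s = (E S\<^sup>s)\<^sup>m |y|\<^sup>2\<^sup>s\<close>. For small \<open>s\<close> of both
  signs these moments are finite, and a Chernoff bound gives \<open>(1/m) ln |P\<^sub>m y|\<^sup>2 \<longrightarrow> E ln S\<close> almost
  surely. Applying this to the basis vectors bounds the growth of all vectors simultaneously, so
  \<open>2 \<mu>\<^sub>1 = E ln S\<close>, and Frullani's integral \<open>ln S = \<integral> (exp (- t) - exp (- t S)) / t dt\<close> finishes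
  the proof.
\<close>

section \<open>Gaussian integrals\<close>

text \<open>The law of \<open>|X v|\<close>, with its dependence on \<open>|v|\<close> alone, comes
  out of a single Laplace transform computation that treats all three number systems at once: for a
  row x, the product of x and v is a real linear map of x whose adjoint multiplies norms by
  \<open>|v|\<close>. Nothing else about the number system enters. Both the row and the beta prime
  variable lead to the same integral over a mixing variable \<tau>; the row dimension \<beta>N
  cancels there, which is why only the parameters \<beta>/2 and \<open>\<omega> l / 2\<close>
  survive. Moments are used because \<open>E S\<^sup>s\<close> is 1 at s = 0 and has derivative
  \<open>E ln S\<close> there. For small s > 0 it therefore lies strictly below
  \<open>exp (s * (E ln S + \<delta>))\<close>, and this gap makes the Chernoff bounds summable; the
  moments of negative order give the matching lower bound. Only the law of each single
  \<open>P\<^sub>m y\<close> enters, so all that is used of the product is that the next factor is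
  independent of the earlier ones. In Frullani's integral the difference has to stay together under
  the expectation, since \<open>exp (- t) / t\<close> alone is not integrable at 0.\<close>

lemma gaussian_fourier_real:
  fixes a v :: real
  assumes "a > 0"
  shows "has_bochner_integral lborel (\<lambda>x. exp (- a * x\<^sup>2) * iexp (v * x))
           (complex_of_real (sqrt (pi / a) * exp (- v\<^sup>2 / (4 * a))))"
proof -
  \<comment> \<open>Chosen so that \<open>(s * x)\<^sup>2 / 2 = a * x\<^sup>2\<close>: rescaling by
    s reduces the claim to the characteristic function of the standard normal law.\<close>
  define s where "s = sqrt (2 * a)"
  have s: "s > 0" "s\<^sup>2 = 2 * a" using assms by (auto simp: s_def)
  define f :: "real \<Rightarrow> complex" where "f x = std_normal_density x *\<^sub>R iexp (v / s * x)" for x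
  have int: "integrable lborel f"
    unfolding f_def using integrable_normal_density[of 1 0]
    by (intro Bochner_Integration.integrable_bound[OF integrable_normal_density[of 1 0]]) auto
  have "integral\<^sup>L lborel f = char std_normal_distribution (v / s)"
    unfolding char_def f_def by (subst integral_density) auto
  also have "\<dots> = exp (- (v / s)\<^sup>2 / 2)"
    by (simp add: char_std_normal_distribution)
  also have "- (v / s)\<^sup>2 / 2 = - (v\<^sup>2 / (4 * a))"
    using s by (simp add: power_divide)
  finally have eq: "integral\<^sup>L lborel f = exp (- (v\<^sup>2 / (4 * a)))"
    by simp
  have "has_bochner_integral lborel (\<lambda>x. f (s * x)) (complex_of_real (exp (- (v\<^sup>2 / (4 * a))) / s))"
    using lborel_has_bochner_integral_real_affine_iff[of s f "complex_of_real (exp (- (v\<^sup>2 / (4 * a))))" 0] s eq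
      has_bochner_integral_integrable[OF int]
    by (simp add: scaleR_conv_of_real field_simps)
  then have "has_bochner_integral lborel (\<lambda>x. sqrt (2 * pi) * f (s * x))
     (sqrt (2 * pi) * complex_of_real (exp (- (v\<^sup>2 / (4 * a))) / s))"
    by (rule has_bochner_integral_mult_right)
  also have "(\<lambda>x. sqrt (2 * pi) * f (s * x)) = (\<lambda>x. exp (- a * x\<^sup>2) * iexp (v * x))"
    using s by (auto simp: f_def std_normal_density_def scaleR_conv_of_real power_mult_distrib fun_eq_iff)
  also have "sqrt (2 * pi) * complex_of_real (exp (- (v\<^sup>2 / (4 * a))) / s) =
      complex_of_real (sqrt (pi / a) * exp (- v\<^sup>2 / (4 * a)))"
    using assms by (simp add: s_def real_sqrt_mult real_sqrt_divide field_simps)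
  finally show ?thesis .
qed

text \<open>The integrand factors over \<open>Basis\<close>, and \<open>lborel\<close> is the image
  of a product of one-dimensional Lebesgue measures under the coordinate map.\<close>

lemma gaussian_fourier:
  fixes v :: "'a::euclidean_space"
  assumes "a > 0"
  shows "has_bochner_integral lborel (\<lambda>x::'a. exp (- a * (norm x)\<^sup>2) * iexp (x \<bullet> v))
           (complex_of_real ((pi / a) powr (DIM('a) / 2) * exp (- (norm v)\<^sup>2 / (4 * a))))"
proof -
  interpret product_sigma_finite "\<lambda>_::'a. lborel :: real measure" ..
  define f :: "'a \<Rightarrow> real \<Rightarrow> complex" where "f b x = exp (- a * x\<^sup>2) * iexp ((v \<bullet> b) * x)" for b x
  have nrm: "(norm x)\<^sup>2 = (\<Sum>b\<in>Basis. (x \<bullet> b)\<^sup>2)" for x :: 'a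
    by (subst power2_norm_eq_inner, subst euclidean_inner) (simp add: power2_eq_square)
  have f: "has_bochner_integral lborel (f b)
      (complex_of_real (sqrt (pi / a) * exp (- (v \<bullet> b)\<^sup>2 / (4 * a))))" for b
    unfolding f_def by (rule gaussian_fourier_real) fact
  have prod_f: "(\<Prod>b\<in>Basis. f b (x \<bullet> b)) = exp (- a * (norm x)\<^sup>2) * iexp (x \<bullet> v)" for x
  proof -
    have "(\<Prod>b\<in>Basis. f b (x \<bullet> b)) =
       (\<Prod>b\<in>Basis. exp (complex_of_real (- a * (x \<bullet> b)\<^sup>2) + \<i> * of_real ((v \<bullet> b) * (x \<bullet> b))))"
      by (simp only: f_def exp_add exp_of_real)
    also have "\<dots> = exp (complex_of_real (- a * (\<Sum>b\<in>Basis. (x \<bullet> b)\<^sup>2)) + \<i> * of_real (\<Sum>b\<in>Basis. (v \<bullet> b) * (x \<bullet> b)))"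
      by (simp add: exp_sum[symmetric] sum.distrib sum_distrib_left sum_negf sum_subtractf)
    also have "(\<Sum>b\<in>Basis. (v \<bullet> b) * (x \<bullet> b)) = x \<bullet> v"
      by (subst euclidean_inner) (simp add: mult.commute)
    finally show ?thesis
      by (simp only: nrm exp_add exp_of_real)
  qed
  have "has_bochner_integral (\<Pi>\<^sub>M b\<in>(Basis::'a set). lborel) (\<lambda>y. \<Prod>b\<in>Basis. f b (y b))
     (\<Prod>b\<in>Basis. complex_of_real (sqrt (pi / a) * exp (- (v \<bullet> b)\<^sup>2 / (4 * a))))"
    unfolding has_bochner_integral_iff
    using f product_integrable_prod[of "Basis :: 'a set" f] product_integral_prod[of "Basis :: 'a set" f]
    by (auto simp: has_bochner_integral_iff)
  moreover have "(\<Prod>b\<in>Basis. complex_of_real (sqrt (pi / a) * exp (- (v \<bullet> b)\<^sup>2 / (4 * a))))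
     = complex_of_real ((pi / a) powr (DIM('a) / 2) * exp (- (norm v)\<^sup>2 / (4 * a)))"
  proof -
    have "(\<Prod>b\<in>Basis. sqrt (pi / a) * exp (- (v \<bullet> b)\<^sup>2 / (4 * a)))
      = sqrt (pi / a) ^ DIM('a) * exp (\<Sum>b\<in>Basis. - (v \<bullet> b)\<^sup>2 / (4 * a))"
      by (simp add: prod.distrib exp_sum)
    also have "(\<Sum>b\<in>Basis. - (v \<bullet> b)\<^sup>2 / (4 * a)) = - (norm v)\<^sup>2 / (4 * a)"
      by (simp add: nrm sum_divide_distrib sum_negf)
    also have "sqrt (pi / a) ^ DIM('a) = (pi / a) powr (DIM('a) / 2)"
      using assms by (simp add: powr_half_sqrt[symmetric] powr_powr powr_realpow[symmetric])
    finally show ?thesis by (simp only: of_real_prod [symmetric])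
  qed
  ultimately show ?thesis
    unfolding lborel_eq[where 'a='a] prod_f[symmetric]
    by (subst has_bochner_integral_distr)
       (auto simp: f_def inner_sum_left inner_Basis if_distrib sum.delta cong: if_cong)
qed

lemma gaussian_integral:
  assumes "a > 0"
  shows "has_bochner_integral lborel (\<lambda>x::'a::euclidean_space. exp (- a * (norm x)\<^sup>2)) ((pi / a) powr (DIM('a) / 2))"
proof -
  have "has_bochner_integral lborel (\<lambda>x::'a. complex_of_real (exp (- a * (norm x)\<^sup>2)))
     (complex_of_real ((pi / a) powr (DIM('a) / 2)))"
    using gaussian_fourier[OF assms, of "0::'a"] by simp
  then show ?thesis
    unfolding has_bochner_integral_iff complex_of_real_integrable_eq integral_complex_of_real of_real_eq_iff .
qed

text \<open>The factor \<open>exp (- t * (norm (A x))\<^sup>2)\<close> is linearised: up to the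
  constant K it is the Fourier transform of a Gaussian in an auxiliary variable g, taken at
  \<open>A x\<close>. After Fubini, x occurs only in \<open>x \<bullet> B g\<close>, and its
  integral depends on g through \<open>norm (B g) = c * norm g\<close>. No diagonalisation of A is
  involved.\<close>

lemma gaussian_integral_linear_image:
  fixes A :: "'a::euclidean_space \<Rightarrow> 'b::euclidean_space"
  assumes "a > 0" "t > 0"
    and A [measurable]: "A \<in> borel_measurable borel"
    and adj: "\<And>x g. A x \<bullet> g = x \<bullet> B g" and nB: "\<And>g. norm (B g) = c * norm g"
  shows "has_bochner_integral lborel (\<lambda>x. exp (- a * (norm x)\<^sup>2) * exp (- t * (norm (A x))\<^sup>2))
     ((pi / a) powr (DIM('a) / 2) * (1 + t * c\<^sup>2 / a) powr (- (DIM('b) / 2)))"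
proof -
  \<comment> \<open>Makes the exponent \<open>- (norm (A x))\<^sup>2 / (4 * s)\<close> of
    \<open>gaussian_fourier\<close> equal to \<open>- t * (norm (A x))\<^sup>2\<close>.\<close>
  define s where "s = 1 / (4 * t)"
  have s: "s > 0" "4 * s * t = 1" using assms by (auto simp: s_def)
  define K where "K = (pi / s) powr (DIM('b) / 2)"
  have K: "K > 0" using s by (simp add: K_def)
  define G :: "'a \<Rightarrow> 'b \<Rightarrow> complex" where
    "G x g = exp (- a * (norm x)\<^sup>2) * (exp (- s * (norm g)\<^sup>2) * iexp (g \<bullet> A x))" for x g
  have G_meas [measurable]: "(\<lambda>(x, g). G x g) \<in> borel_measurable (lborel \<Otimes>\<^sub>M lborel)"
    unfolding G_def by measurable
  have normG: "norm (G x g) = exp (- a * (norm x)\<^sup>2) * exp (- s * (norm g)\<^sup>2)" for x g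
    by (simp add: G_def norm_mult)
  note gi = gaussian_integral[unfolded has_bochner_integral_iff]
  note gf = gaussian_fourier[unfolded has_bochner_integral_iff]
  have intG: "integrable (lborel \<Otimes>\<^sub>M lborel) (\<lambda>(x, g). G x g)"
  proof (rule lborel_pair.Fubini_integrable)
    show "integrable lborel (\<lambda>x. LINT g|lborel. norm (case (x, g) of (x, g) \<Rightarrow> G x g))"
      using gi[where 'a='a] assms by (simp add: normG)
    show "AE x in lborel. integrable lborel (\<lambda>g. case (x, g) of (x, g) \<Rightarrow> G x g)"
      unfolding G_def using gf[where 'a='b, OF s(1)]
      by auto
  qed simp
  have 1: "(LINT g|lborel. G x g) = complex_of_real (K * (exp (- a * (norm x)\<^sup>2) * exp (- t * (norm (A x))\<^sup>2)))" for x
  proof -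
    have "(LINT g|lborel. G x g) = exp (- a * (norm x)\<^sup>2) * (K * exp (- (norm (A x))\<^sup>2 / (4 * s)))"
      unfolding G_def K_def using gf[where 'a='b, OF s(1), of "A x"] by simp
    also have "- (norm (A x))\<^sup>2 / (4 * s) = - t * (norm (A x))\<^sup>2"
      using s assms by (simp add: s_def)
    finally show ?thesis by (simp add: mult_ac)
  qed
  have 2: "(LINT x|lborel. G x g) =
      complex_of_real ((pi / a) powr (DIM('a) / 2) * exp (- (s + c\<^sup>2 / (4 * a)) * (norm g)\<^sup>2))" for g
  proof -
    have "(LINT x|lborel. G x g) =
        (LINT x|lborel. exp (- s * (norm g)\<^sup>2) * (exp (- a * (norm x)\<^sup>2) * iexp (x \<bullet> B g)))"
      by (intro Bochner_Integration.integral_cong) (simp_all add: G_def adj[symmetric] inner_commute)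
    also have "\<dots> = exp (- s * (norm g)\<^sup>2) * ((pi / a) powr (DIM('a) / 2) * exp (- (norm (B g))\<^sup>2 / (4 * a)))"
      using gf[where 'a='a, OF assms(1), of "B g"] by simp
    also have "\<dots> = complex_of_real ((pi / a) powr (DIM('a) / 2) *
        exp (- s * (norm g)\<^sup>2 + - (norm (B g))\<^sup>2 / (4 * a)))"
      by (simp only: exp_add of_real_mult mult_ac)
    also have "- s * (norm g)\<^sup>2 + - (norm (B g))\<^sup>2 / (4 * a) = - (s + c\<^sup>2 / (4 * a)) * (norm g)\<^sup>2"
      by (simp add: nB field_simps)
    finally show ?thesis .
  qed
  have pos: "s + c\<^sup>2 / (4 * a) > 0" using s assms by (simp add: add_pos_nonneg)
  have "integrable lborel (\<lambda>x. complex_of_real (K * (exp (- a * (norm x)\<^sup>2) * exp (- t * (norm (A x))\<^sup>2))))"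
    using lborel_pair.integrable_fst'[OF intG] by (simp only: 1 split_beta fst_conv snd_conv)
  then have int: "integrable lborel (\<lambda>x. K * (exp (- a * (norm x)\<^sup>2) * exp (- t * (norm (A x))\<^sup>2)))"
    unfolding complex_of_real_integrable_eq .
  have "complex_of_real (LINT x|lborel. K * (exp (- a * (norm x)\<^sup>2) * exp (- t * (norm (A x))\<^sup>2))) =
      (LINT x|lborel. LINT g|lborel. G x g)"
    unfolding 1 by (rule integral_complex_of_real[symmetric])
  also have "\<dots> = (LINT g|lborel. LINT x|lborel. G x g)"
    by (rule lborel_pair.Fubini_integral[OF intG, symmetric])
  also have "\<dots> = complex_of_real ((pi / a) powr (DIM('a) / 2) * (pi / (s + c\<^sup>2 / (4 * a))) powr (DIM('b) / 2))"
    unfolding 2 integral_complex_of_real using gi[where 'a='b, OF pos] by simp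
  finally have "(LINT x|lborel. K * (exp (- a * (norm x)\<^sup>2) * exp (- t * (norm (A x))\<^sup>2))) =
     (pi / a) powr (DIM('a) / 2) * (pi / (s + c\<^sup>2 / (4 * a))) powr (DIM('b) / 2)"
    unfolding of_real_eq_iff .
  also have "pi / (s + c\<^sup>2 / (4 * a)) = pi / s * (1 / (1 + t * c\<^sup>2 / a))"
    using s assms pos by (simp add: s_def field_simps)
  also have "(pi / s * (1 / (1 + t * c\<^sup>2 / a))) powr (DIM('b) / 2) = K * (1 + t * c\<^sup>2 / a) powr (- (DIM('b) / 2))"
    using s assms by (simp add: K_def powr_mult powr_divide powr_minus_divide)
  finally have "(LINT x|lborel. exp (- a * (norm x)\<^sup>2) * exp (- t * (norm (A x))\<^sup>2)) =
     (pi / a) powr (DIM('a) / 2) * (1 + t * c\<^sup>2 / a) powr (- (DIM('b) / 2))"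
    using K by (simp add: field_simps)
  with int K show ?thesis by (simp add: has_bochner_integral_iff)
qed

section \<open>The beta prime distribution\<close>

lemma nn_integral_Gamma:
  fixes a b :: real
  assumes "a > 0" "b > 0"
  shows "(\<integral>\<^sup>+x. ennreal (indicator {0<..} x * (x powr (a - 1) * exp (- b * x))) \<partial>lborel) = ennreal (Gamma a / b powr a)"
    (is "?I = _")
proof -
  have "ennreal (Gamma a) = (\<integral>\<^sup>+x. ennreal (indicator {0..} x * x powr (a - 1) / exp x) \<partial>lborel)"
    using assms by (simp add: Gamma_conv_nn_integral_real)
  also have "\<dots> = \<bar>b\<bar> * (\<integral>\<^sup>+x. ennreal (indicator {0..} (0 + b * x) * (0 + b * x) powr (a - 1) / exp (0 + b * x)) \<partial>lborel)"
    using assms by (intro nn_integral_real_affine) auto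
  \<comment> \<open>The passage from \<open>{0..}\<close> to \<open>{0<..}\<close> is a pointwise
    equality, because \<open>0 powr (a - 1) = 0\<close>.\<close>
  also have "(\<lambda>x. ennreal (indicator {0..} (0 + b * x) * (0 + b * x) powr (a - 1) / exp (0 + b * x))) =
      (\<lambda>x. ennreal (b powr (a - 1)) * ennreal (indicator {0<..} x * (x powr (a - 1) * exp (- b * x))))"
    using assms
    by (auto simp: fun_eq_iff ennreal_mult[symmetric] indicator_def zero_le_mult_iff powr_mult exp_minus field_simps)
  also have "(\<integral>\<^sup>+x. ennreal (b powr (a - 1)) * ennreal (indicator {0<..} x * (x powr (a - 1) * exp (- b * x))) \<partial>lborel)
      = ennreal (b powr (a - 1)) * ?I"
    by (intro nn_integral_cmult) simp
  finally have *: "ennreal (Gamma a) = ennreal (b powr a) * ?I"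
    using assms by (simp add: mult.assoc[symmetric] ennreal_mult[symmetric] powr_mult_base)
  have "ennreal (1 / b powr a) * ennreal (Gamma a) = ennreal (1 / b powr a * b powr a) * ?I"
    unfolding * using assms by (subst ennreal_mult) (simp_all add: mult.assoc)
  then show ?thesis
    using assms by (simp add: ennreal_mult[symmetric])
qed

text \<open>Constants are moved across an integral by comparing real integrands, where field
  arithmetic is available, instead of cancelling in \<open>ennreal\<close>.\<close>

lemma nn_integral_cmult_eq_cmult:
  fixes f g :: "'a \<Rightarrow> real"
  assumes [measurable]: "f \<in> borel_measurable M" "g \<in> borel_measurable M"
    and "c \<ge> 0" "d \<ge> 0" "\<And>x. c * f x = d * g x"
  shows "ennreal c * (\<integral>\<^sup>+x. ennreal (f x) \<partial>M) = ennreal d * (\<integral>\<^sup>+x. ennreal (g x) \<partial>M)"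
  using assms by (simp add: nn_integral_cmult[symmetric] ennreal_mult'[symmetric])

text \<open>The law of the quotient of two independent gamma variables with shapes a and b and equal
  scale.\<close>

definition beta_prime_density :: "real \<Rightarrow> real \<Rightarrow> real \<Rightarrow> real" where
  "beta_prime_density a b s = indicator {0<..} s *
     (Gamma (a + b) / (Gamma a * Gamma b) * (s powr (a - 1) * (1 + s) powr (- (a + b))))"

lemma measurable_beta_prime_density [measurable]: "beta_prime_density a b \<in> borel_measurable borel"
  unfolding beta_prime_density_def by measurable

lemma beta_prime_density_nonneg: "a > 0 \<Longrightarrow> b > 0 \<Longrightarrow> beta_prime_density a b s \<ge> 0"
  by (simp add: beta_prime_density_def)

text \<open>The Gamma integral read backwards: it introduces the mixing variable \<tau>, turning a
  power of \<open>1 + s\<close> into exponentials and a power of \<open>1 + (norm x)\<^sup>2\<close>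
  into Gaussians.\<close>

lemma powr_neg_eq_nn_integral:
  fixes c x :: real
  assumes "c > 0" "x > 0"
  shows "ennreal (x powr (- c)) =
    ennreal (1 / Gamma c) * (\<integral>\<^sup>+\<tau>. ennreal (indicator {0<..} \<tau> * (\<tau> powr (c - 1) * exp (- x * \<tau>))) \<partial>lborel)"
  using assms less_imp_neq[OF Gamma_real_pos[of c]]
  by (subst nn_integral_Gamma) (auto simp: ennreal_mult[symmetric] powr_minus_divide)

text \<open>Writing \<open>(1 + s) powr (- (a + b))\<close> as a mixture over \<tau> leaves a Gamma
  integral in s. The \<tau>-integral is deliberately not evaluated: it is the common form in which
  this transform meets that of a row in \<open>beta_II_laplace\<close>.\<close>

lemma beta_prime_laplace:
  assumes ab: "a > 0" "b > 0" and "t \<ge> 0"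
  shows "(\<integral>\<^sup>+s. ennreal (beta_prime_density a b s) * ennreal (exp (- t * s)) \<partial>lborel) =
    ennreal (1 / Gamma b) *
      (\<integral>\<^sup>+\<tau>. ennreal (indicator {0<..} \<tau> * (\<tau> powr (a + b - 1) * exp (- \<tau>) * (t + \<tau>) powr (- a))) \<partial>lborel)"
proof -
  have G: "Gamma a > 0" "Gamma b > 0" "Gamma (a + b) > 0"
    using ab by (auto intro: Gamma_real_pos)
  define g :: "real \<Rightarrow> real \<Rightarrow> real" where
    "g s \<tau> = indicator {0<..} s * indicator {0<..} \<tau> * (s powr (a - 1) * \<tau> powr (a + b - 1) * exp (- (1 + s) * \<tau> - t * s))"
    for s \<tau>
  have [measurable]: "(\<lambda>(s, \<tau>). ennreal (g s \<tau>)) \<in> borel_measurable (lborel \<Otimes>\<^sub>M lborel)"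
    unfolding g_def by measurable
  have 1: "ennreal (beta_prime_density a b s) * ennreal (exp (- t * s)) =
      ennreal (1 / (Gamma a * Gamma b)) * (\<integral>\<^sup>+\<tau>. ennreal (g s \<tau>) \<partial>lborel)" for s
  proof (cases "s > 0")
    case True
    have "ennreal (beta_prime_density a b s) * ennreal (exp (- t * s)) =
      ennreal (Gamma (a + b) / (Gamma a * Gamma b) * (s powr (a - 1) * exp (- t * s))) * ennreal ((1 + s) powr (- (a + b)))"
      using True G by (simp add: beta_prime_density_def ennreal_mult[symmetric] mult_ac)
    also have "\<dots> = ennreal (1 / (Gamma a * Gamma b) * (s powr (a - 1) * exp (- t * s))) *
       (\<integral>\<^sup>+\<tau>. ennreal (indicator {0<..} \<tau> * (\<tau> powr (a + b - 1) * exp (- (1 + s) * \<tau>))) \<partial>lborel)"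
      using True G ab less_imp_neq[OF G(3)] by (subst powr_neg_eq_nn_integral)
        (auto simp: mult.assoc[symmetric] ennreal_mult[symmetric] simp del: mult_minus_left)
    also have "\<dots> = ennreal (1 / (Gamma a * Gamma b)) * (\<integral>\<^sup>+\<tau>. ennreal (g s \<tau>) \<partial>lborel)"
      using True G by (intro nn_integral_cmult_eq_cmult) (auto simp: g_def exp_diff exp_minus exp_add field_simps)
    finally show ?thesis .
  qed (simp add: beta_prime_density_def g_def)
  have 2: "(\<integral>\<^sup>+s. ennreal (g s \<tau>) \<partial>lborel) =
      ennreal (Gamma a) * ennreal (indicator {0<..} \<tau> * (\<tau> powr (a + b - 1) * exp (- \<tau>) * (t + \<tau>) powr (- a)))" for \<tau>
  proof (cases "\<tau> > 0")
    case True
    have "(\<integral>\<^sup>+s. ennreal (g s \<tau>) \<partial>lborel) = (\<integral>\<^sup>+s. ennreal (\<tau> powr (a + b - 1) * exp (- \<tau>)) *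
        ennreal (indicator {0<..} s * (s powr (a - 1) * exp (- (t + \<tau>) * s))) \<partial>lborel)"
      using True by (intro nn_integral_cong)
        (auto simp: g_def ennreal_mult[symmetric] indicator_def exp_add[symmetric] algebra_simps)
    also have "\<dots> = ennreal (\<tau> powr (a + b - 1) * exp (- \<tau>)) * ennreal (Gamma a / (t + \<tau>) powr a)"
      using nn_integral_Gamma[of a "t + \<tau>"] True assms by (subst nn_integral_cmult) simp_all
    finally show ?thesis using True G by (simp add: ennreal_mult[symmetric] powr_minus_divide mult_ac)
  qed (simp add: g_def)
  have "(\<integral>\<^sup>+s. ennreal (beta_prime_density a b s) * ennreal (exp (- t * s)) \<partial>lborel) =
      ennreal (1 / (Gamma a * Gamma b)) * (\<integral>\<^sup>+s. \<integral>\<^sup>+\<tau>. ennreal (g s \<tau>) \<partial>lborel \<partial>lborel)"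
    unfolding 1 by (intro nn_integral_cmult) measurable
  also have "(\<integral>\<^sup>+s. \<integral>\<^sup>+\<tau>. ennreal (g s \<tau>) \<partial>lborel \<partial>lborel) = (\<integral>\<^sup>+\<tau>. \<integral>\<^sup>+s. ennreal (g s \<tau>) \<partial>lborel \<partial>lborel)"
    by (intro lborel_pair.Fubini'[symmetric]) measurable
  finally show ?thesis
    unfolding 2 using G less_imp_neq[OF G(1)]
    by (subst (asm) nn_integral_cmult) (simp_all add: mult.assoc[symmetric] ennreal_mult[symmetric])
qed

text \<open>At \<open>t = 0\<close> the mixing integral collapses to \<open>Gamma b\<close>, so the
  normalisation follows from the Laplace transform.\<close>

lemma nn_integral_beta_prime_density:
  assumes "a > 0" "b > 0"
  shows "(\<integral>\<^sup>+s. ennreal (beta_prime_density a b s) \<partial>lborel) = 1"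
proof -
  have "(\<integral>\<^sup>+s. ennreal (beta_prime_density a b s) \<partial>lborel) =
    ennreal (1 / Gamma b) *
      (\<integral>\<^sup>+\<tau>. ennreal (indicator {0<..} \<tau> * (\<tau> powr (a + b - 1) * exp (- \<tau>) * \<tau> powr (- a))) \<partial>lborel)"
    using beta_prime_laplace[OF assms, of 0] by simp
  also have "(\<lambda>\<tau>::real. indicator {0<..} \<tau> * (\<tau> powr (a + b - 1) * exp (- \<tau>) * \<tau> powr (- a))) =
       (\<lambda>\<tau>. indicator {0<..} \<tau> * (\<tau> powr (b - 1) * exp (- 1 * \<tau>)))"
    by (auto simp: fun_eq_iff indicator_def powr_add[symmetric] mult.commute[of _ "exp _"] mult.assoc)
  also have "ennreal (1 / Gamma b) * (\<integral>\<^sup>+\<tau>. ennreal (indicator {0<..} \<tau> * (\<tau> powr (b - 1) * exp (- 1 * \<tau>))) \<partial>lborel) = 1"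
    using assms less_imp_neq[OF Gamma_real_pos[of b]] by (subst nn_integral_Gamma) (auto simp: ennreal_mult[symmetric])
  finally show ?thesis .
qed

lemma prob_space_beta_prime: "a > 0 \<Longrightarrow> b > 0 \<Longrightarrow> prob_space (density lborel (\<lambda>s. ennreal (beta_prime_density a b s)))"
  by (intro prob_spaceI) (simp add: emeasure_density nn_integral_beta_prime_density)

text \<open>Multiplication by \<open>s powr p\<close> shifts the parameters to \<open>a + p\<close>
  and \<open>b - p\<close> and keeps their sum, so up to the constant K the integrand is another
  beta prime density.\<close>

lemma beta_prime_moment_finite:
  assumes "a > 0" "b > 0" "a + p > 0" "b - p > 0"
  shows "(\<integral>\<^sup>+s. ennreal (beta_prime_density a b s) * ennreal (s powr p) \<partial>lborel) < \<infinity>"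
proof -
  define K where "K = Gamma (a + b) / (Gamma a * Gamma b) / (Gamma (a + b) / (Gamma (a + p) * Gamma (b - p)))"
  have G: "Gamma a > 0" "Gamma b > 0" "Gamma (a + b) > 0" "Gamma (a + p) > 0" "Gamma (b - p) > 0"
    using assms by (auto intro: Gamma_real_pos)
  have "ennreal (beta_prime_density a b s) * ennreal (s powr p) = ennreal K * ennreal (beta_prime_density (a + p) (b - p) s)" for s
  proof (cases "s > 0")
    case True
    have "s powr (a + p - 1) = s powr (a - 1) * s powr p"
      using True by (simp add: powr_add[symmetric] algebra_simps)
    then show ?thesis using True G
      by (simp add: beta_prime_density_def K_def ennreal_mult[symmetric])
  qed (simp add: beta_prime_density_def)
  then show ?thesis
    using assms by (simp add: nn_integral_cmult nn_integral_beta_prime_density)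
qed

text \<open>Given \<tau> the row is Gaussian, so \<open>gaussian_integral_linear_image\<close>
  integrates it out, and what remains is the \<tau>-integral of \<open>beta_prime_laplace\<close> at
  \<open>t * c\<^sup>2\<close>. The density is spelled out over a general space \<open>'e\<close>;
  it is applied to rows, where \<open>DIM('e)\<close> is \<beta>N.\<close>

lemma beta_II_laplace:
  fixes A :: "'e::euclidean_space \<Rightarrow> 'b::euclidean_space" and \<omega> :: real
  assumes "\<omega> > 0" "t > 0"
    and A [measurable]: "A \<in> borel_measurable borel"
    and adj: "\<And>x g. A x \<bullet> g = x \<bullet> B g" and nB: "\<And>g. norm (B g) = c * norm g"
  shows "(\<integral>\<^sup>+x. ennreal (pi powr (- real DIM('e) / 2) * gen_pochhammer (\<omega> / 2) (DIM('e) / 2) *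
       (1 + (norm x)\<^sup>2) powr (- (DIM('e) + \<omega>) / 2)) * ennreal (exp (- t * (norm (A x))\<^sup>2)) \<partial>lborel)
     = (\<integral>\<^sup>+s. ennreal (beta_prime_density (DIM('b) / 2) (\<omega> / 2) s) * ennreal (exp (- (t * c\<^sup>2) * s)) \<partial>lborel)"
proof -
  define d where "d = real DIM('e)"
  define b where "b = real DIM('b) / 2"
  have d: "d > 0" and b: "b > 0" by (auto simp: d_def b_def)
  have G: "Gamma ((d + \<omega>) / 2) > 0" "Gamma (\<omega> / 2) > 0"
    using assms d by (auto intro!: Gamma_real_pos)
  define g :: "'e \<Rightarrow> real \<Rightarrow> real" where
    "g x \<tau> = indicator {0<..} \<tau> * (\<tau> powr ((d + \<omega>) / 2 - 1) * exp (- (1 + (norm x)\<^sup>2) * \<tau>) * exp (- t * (norm (A x))\<^sup>2))"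
    for x \<tau>
  have [measurable]: "(\<lambda>(x, \<tau>). ennreal (g x \<tau>)) \<in> borel_measurable (lborel \<Otimes>\<^sub>M lborel)"
    unfolding g_def by measurable
  have 1: "ennreal (pi powr (- d / 2) * gen_pochhammer (\<omega> / 2) (d / 2) *
       (1 + (norm x)\<^sup>2) powr (- (d + \<omega>) / 2)) * ennreal (exp (- t * (norm (A x))\<^sup>2)) =
      ennreal (pi powr (- d / 2) / Gamma (\<omega> / 2)) * (\<integral>\<^sup>+\<tau>. ennreal (g x \<tau>) \<partial>lborel)" for x
  proof -
    have gp: "gen_pochhammer (\<omega> / 2) (d / 2) = Gamma ((d + \<omega>) / 2) / Gamma (\<omega> / 2)"
      by (simp add: gen_pochhammer_def add_divide_distrib add.commute)
    have neg: "- (d + \<omega>) / 2 = - ((d + \<omega>) / 2)" by (simp only: minus_divide_left)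
    have "ennreal (pi powr (- d / 2) * gen_pochhammer (\<omega> / 2) (d / 2) *
       (1 + (norm x)\<^sup>2) powr (- (d + \<omega>) / 2)) * ennreal (exp (- t * (norm (A x))\<^sup>2)) =
       ennreal (pi powr (- d / 2) * (Gamma ((d + \<omega>) / 2) / Gamma (\<omega> / 2)) * exp (- t * (norm (A x))\<^sup>2)) *
       ennreal ((1 + (norm x)\<^sup>2) powr (- ((d + \<omega>) / 2)))"
      unfolding gp neg using G by (simp add: ennreal_mult[symmetric] mult_ac)
    also have "\<dots> = ennreal (pi powr (- d / 2) / Gamma (\<omega> / 2) * exp (- t * (norm (A x))\<^sup>2)) *
      (\<integral>\<^sup>+\<tau>. ennreal (indicator {0<..} \<tau> * (\<tau> powr ((d + \<omega>) / 2 - 1) * exp (- (1 + (norm x)\<^sup>2) * \<tau>))) \<partial>lborel)"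
      using G d assms less_imp_neq[OF G(1)] by (subst powr_neg_eq_nn_integral) (auto simp: mult.assoc[symmetric] ennreal_mult[symmetric] add_pos_nonneg simp del: mult_minus_left)
    also have "\<dots> = ennreal (pi powr (- d / 2) / Gamma (\<omega> / 2)) * (\<integral>\<^sup>+\<tau>. ennreal (g x \<tau>) \<partial>lborel)"
      using G by (intro nn_integral_cmult_eq_cmult) (auto simp: g_def)
    finally show ?thesis .
  qed
  have 2: "(\<integral>\<^sup>+x. ennreal (g x \<tau>) \<partial>lborel) = ennreal (pi powr (d / 2)) *
     ennreal (indicator {0<..} \<tau> * (\<tau> powr (b + \<omega> / 2 - 1) * exp (- \<tau>) * (t * c\<^sup>2 + \<tau>) powr (- b)))" for \<tau>
  proof (cases "\<tau> > 0")
    case True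
    have "(\<integral>\<^sup>+x. ennreal (g x \<tau>) \<partial>lborel) = (\<integral>\<^sup>+x. ennreal (\<tau> powr ((d + \<omega>) / 2 - 1) * exp (- \<tau>)) *
        ennreal (exp (- \<tau> * (norm x)\<^sup>2) * exp (- t * (norm (A x))\<^sup>2)) \<partial>lborel)"
      using True by (intro nn_integral_cong)
        (auto simp: g_def ennreal_mult[symmetric] exp_add[symmetric] algebra_simps)
    also have "\<dots> = ennreal (\<tau> powr ((d + \<omega>) / 2 - 1) * exp (- \<tau>)) *
        (\<integral>\<^sup>+x. ennreal (exp (- \<tau> * (norm x)\<^sup>2) * exp (- t * (norm (A x))\<^sup>2)) \<partial>lborel)"
      by (intro nn_integral_cmult) measurable
    also have "(\<integral>\<^sup>+x. ennreal (exp (- \<tau> * (norm x)\<^sup>2) * exp (- t * (norm (A x))\<^sup>2)) \<partial>lborel) =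
        ennreal ((pi / \<tau>) powr (d / 2) * (1 + t * c\<^sup>2 / \<tau>) powr (- b))"
      using gaussian_integral_linear_image[OF True assms(2-5)]
      by (simp add: has_bochner_integral_iff nn_integral_eq_integral d_def b_def)
    also have "1 + t * c\<^sup>2 / \<tau> = (t * c\<^sup>2 + \<tau>) / \<tau>"
      using True by (simp add: field_simps)
    also have "((t * c\<^sup>2 + \<tau>) / \<tau>) powr (- b) = (t * c\<^sup>2 + \<tau>) powr (- b) * \<tau> powr b"
      using True assms by (simp add: powr_divide powr_minus_divide)
    also have "ennreal (\<tau> powr ((d + \<omega>) / 2 - 1) * exp (- \<tau>)) *
        ennreal ((pi / \<tau>) powr (d / 2) * ((t * c\<^sup>2 + \<tau>) powr (- b) * \<tau> powr b)) =
        ennreal (pi powr (d / 2) * ((\<tau> powr ((d + \<omega>) / 2 - 1) * \<tau> powr (- (d / 2)) * \<tau> powr b) *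
          exp (- \<tau>) * (t * c\<^sup>2 + \<tau>) powr (- b)))"
      using True by (simp add: ennreal_mult[symmetric] powr_divide powr_minus_divide mult_ac)
    \<comment> \<open>Here the dimension d of the row cancels and only b, half the dimension of the
      target, is left.\<close>
    also have "\<tau> powr ((d + \<omega>) / 2 - 1) * \<tau> powr (- (d / 2)) * \<tau> powr b = \<tau> powr (b + \<omega> / 2 - 1)"
      using True by (simp add: powr_add[symmetric] add_divide_distrib algebra_simps)
    finally show ?thesis using True by (simp add: ennreal_mult[symmetric])
  qed (simp add: g_def)
  have "(\<integral>\<^sup>+x. ennreal (pi powr (- d / 2) * gen_pochhammer (\<omega> / 2) (d / 2) *
       (1 + (norm x)\<^sup>2) powr (- (d + \<omega>) / 2)) * ennreal (exp (- t * (norm (A x))\<^sup>2)) \<partial>lborel) =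
      ennreal (pi powr (- d / 2) / Gamma (\<omega> / 2)) * (\<integral>\<^sup>+x. \<integral>\<^sup>+\<tau>. ennreal (g x \<tau>) \<partial>lborel \<partial>lborel)"
    unfolding 1 by (intro nn_integral_cmult) measurable
  also have "(\<integral>\<^sup>+x. \<integral>\<^sup>+\<tau>. ennreal (g x \<tau>) \<partial>lborel \<partial>lborel) = (\<integral>\<^sup>+\<tau>. \<integral>\<^sup>+x. ennreal (g x \<tau>) \<partial>lborel \<partial>lborel)"
    by (intro lborel_pair.Fubini'[symmetric]) measurable
  also have "\<dots> = ennreal (pi powr (d / 2)) *
     (\<integral>\<^sup>+\<tau>. ennreal (indicator {0<..} \<tau> * (\<tau> powr (b + \<omega> / 2 - 1) * exp (- \<tau>) * (t * c\<^sup>2 + \<tau>) powr (- b))) \<partial>lborel)"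
    unfolding 2 by (intro nn_integral_cmult) measurable
  also have "ennreal (pi powr (- d / 2) / Gamma (\<omega> / 2)) * \<dots> =
     (\<integral>\<^sup>+s. ennreal (beta_prime_density b (\<omega> / 2) s) * ennreal (exp (- (t * c\<^sup>2) * s)) \<partial>lborel)"
    using assms G b by (subst beta_prime_laplace)
      (simp_all add: mult.assoc[symmetric] ennreal_mult[symmetric] powr_minus_divide)
  finally show ?thesis by (simp only: d_def b_def)
qed

section \<open>Uniqueness of the Laplace transform\<close>

text \<open>The Taylor remainder is at most \<open>2 * \<bar>t\<bar> ^ n / fact n\<close> because
  every moment is at most 1. Hence the integer moments of a variable in \<open>[0, 1]\<close>
  determine its characteristic function.\<close>

lemma (in prob_space) char_bounded_series:
  fixes Y :: "'a \<Rightarrow> real"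
  assumes Y [measurable]: "Y \<in> borel_measurable M" and b: "\<And>x. 0 \<le> Y x" "\<And>x. Y x \<le> 1"
  shows "(\<lambda>n. \<Sum>k\<le>n. ((\<i> * t) ^ k / fact k) * expectation (\<lambda>x. Y x ^ k)) \<longlonglongrightarrow> char (distr M borel Y) t"
proof (rule metric_tendsto_imp_tendsto)
  have int: "integrable M (\<lambda>x. Y x ^ k)" for k
    using b by (intro integrable_const_bound[of _ 1]) (auto simp: power_le_one)
  have "(\<lambda>n. 2 * (\<bar>t\<bar> ^ n / fact n)) \<longlonglongrightarrow> 2 * 0"
    using summable_LIMSEQ_zero[OF summable_exp[of "\<bar>t\<bar>"]]
    by (intro tendsto_mult_left) (simp add: divide_inverse mult.commute)
  then show "(\<lambda>n. 2 * \<bar>t\<bar> ^ n / fact n) \<longlonglongrightarrow> 0" by simp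
  show "\<forall>\<^sub>F n in sequentially.
      dist (\<Sum>k\<le>n. ((\<i> * t) ^ k / fact k) * expectation (\<lambda>x. Y x ^ k)) (char (distr M borel Y) t)
      \<le> dist (2 * \<bar>t\<bar> ^ n / fact n) 0"
  proof (intro always_eventually allI)
    fix n
    have "dist (\<Sum>k\<le>n. ((\<i> * t) ^ k / fact k) * expectation (\<lambda>x. Y x ^ k)) (char (distr M borel Y) t)
        \<le> (2 * \<bar>t\<bar> ^ n / fact n) * expectation (\<lambda>x. \<bar>Y x\<bar> ^ n)"
      using char_approx1'[of n Y "distr M borel Y" t] int
      by (simp add: dist_norm norm_minus_commute)
    also have "expectation (\<lambda>x. \<bar>Y x\<bar> ^ n) \<le> expectation (\<lambda>x. 1)"
      using b int[of n] by (intro integral_mono) (auto simp: power_le_one)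
    then have "(2 * \<bar>t\<bar> ^ n / fact n) * expectation (\<lambda>x. \<bar>Y x\<bar> ^ n) \<le> (2 * \<bar>t\<bar> ^ n / fact n) * 1"
      by (intro mult_left_mono) (simp_all add: prob_space)
    finally show "dist (\<Sum>k\<le>n. ((\<i> * t) ^ k / fact k) * expectation (\<lambda>x. Y x ^ k)) (char (distr M borel Y) t)
      \<le> dist (2 * \<bar>t\<bar> ^ n / fact n) 0"
      by simp
  qed
qed

text \<open>Substituting \<open>y = exp (- z)\<close> makes this the moment problem on \<open>[0, 1]\<close>.\<close>

lemma distr_eqI_laplace:
  fixes Z :: "'a \<Rightarrow> real" and W :: "'b \<Rightarrow> real"
  assumes M: "prob_space M" and N: "prob_space N"
    and Z [measurable]: "Z \<in> borel_measurable M" and W [measurable]: "W \<in> borel_measurable N"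
    and nn: "\<And>x. Z x \<ge> 0" "\<And>y. W y \<ge> 0"
    and eq: "\<And>t. t > 0 \<Longrightarrow> (\<integral>\<^sup>+x. ennreal (exp (- t * Z x)) \<partial>M) = (\<integral>\<^sup>+y. ennreal (exp (- t * W y)) \<partial>N)"
  shows "distr M borel Z = distr N borel W"
proof -
  interpret M: prob_space M by fact
  interpret N: prob_space N by fact
  \<comment> \<open>The k-th moment is the Laplace transform at t = k; the case k = 0 lies outside
    \<open>eq\<close> and is the total mass.\<close>
  have mom: "(LINT x|M. exp (- Z x) ^ k) = (LINT y|N. exp (- W y) ^ k)" for k
  proof (cases "k = 0")
    case False
    then show ?thesis
      using eq[of "real k"] by (simp add: integral_eq_nn_integral exp_of_nat_mult[symmetric])
  qed (simp add: M.prob_space N.prob_space)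
  have "distr M borel (\<lambda>x. exp (- Z x)) = distr N borel (\<lambda>y. exp (- W y))"
  proof (rule Levy_uniqueness)
    show "char (distr M borel (\<lambda>x. exp (- Z x))) = char (distr N borel (\<lambda>y. exp (- W y)))"
    proof
      fix t
      show "char (distr M borel (\<lambda>x. exp (- Z x))) t = char (distr N borel (\<lambda>y. exp (- W y))) t"
        using M.char_bounded_series[of "\<lambda>x. exp (- Z x)" t] N.char_bounded_series[of "\<lambda>y. exp (- W y)" t]
        by (intro LIMSEQ_unique) (simp_all add: nn mom)
    qed
  qed (simp_all add: M.real_distribution_distr N.real_distribution_distr)
  then have "distr (distr M borel (\<lambda>x. exp (- Z x))) borel (\<lambda>y. - ln y) =
      distr (distr N borel (\<lambda>y. exp (- W y))) borel (\<lambda>y. - ln y)"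
    by simp
  then show ?thesis
    by (simp add: distr_distr o_def)
qed

section \<open>The expected logarithm\<close>

lemma exp_minus_one_bound:
  fixes z :: real
  shows "\<bar>exp z - 1\<bar> \<le> \<bar>z\<bar> * exp \<bar>z\<bar>"
proof (cases "z \<ge> 0")
  case True
  have "(1 - exp (- z)) * exp z \<le> z * exp z"
    using exp_ge_add_one_self[of "- z"] by (intro mult_right_mono) auto
  then show ?thesis using True by (simp add: algebra_simps exp_minus)
next
  case False
  have "1 - exp z \<le> - z" using exp_ge_add_one_self[of z] by linarith
  also have "\<dots> \<le> - z * exp (- z)" using False by simp
  finally show ?thesis using False by simp
qed

lemma (in prob_space) exp_moments_imp_integrable:
  fixes Y :: "'a \<Rightarrow> real"
  assumes Y [measurable]: "Y \<in> borel_measurable M" and l: "l > 0"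
    and int: "integrable M (\<lambda>x. exp (l * Y x))" "integrable M (\<lambda>x. exp (- l * Y x))"
    and s: "\<bar>s\<bar> \<le> l"
  shows "integrable M (\<lambda>x. exp (s * Y x))"
proof (rule Bochner_Integration.integrable_bound)
  show "integrable M (\<lambda>x. exp (l * Y x) + exp (- l * Y x))"
    using int by simp
  have "s * y \<le> l * \<bar>y\<bar>" for y
    using mult_right_mono[OF s, of "\<bar>y\<bar>"] abs_le_D1[of "s * y" "\<bar>s\<bar> * \<bar>y\<bar>"] by (simp add: abs_mult)
  then have "exp (s * y) \<le> exp (l * \<bar>y\<bar>)" for y by simp
  moreover have "exp (l * \<bar>y\<bar>) \<le> exp (l * y) + exp (- l * y)" for y
    by (cases "y \<ge> 0") auto
  ultimately have "exp (s * y) \<le> exp (l * y) + exp (- l * y)" for y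
    by (rule order_trans)
  then show "AE x in M. norm (exp (s * Y x)) \<le> norm (exp (l * Y x) + exp (- l * Y x))"
    by (simp add: abs_of_nonneg add_nonneg_nonneg)
qed measurable

text \<open>The difference quotients of \<open>s \<mapsto> E exp (s Y)\<close> at 0 converge to
  \<open>E Y\<close> by dominated convergence. For small s > 0 this gives
  \<open>E exp (s Y) < 1 + s (E Y + \<delta>)\<close>, and \<open>1 + u \<le> exp u\<close>
  finishes. The strict inequality supplies the ratio below 1 in the Chernoff bound.\<close>

lemma (in prob_space) exp_moment_tangent:
  fixes Y :: "'a \<Rightarrow> real"
  assumes Y [measurable]: "Y \<in> borel_measurable M" and l: "l > 0"
    and int: "integrable M (\<lambda>x. exp (l * Y x))" "integrable M (\<lambda>x. exp (- l * Y x))"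
  shows "integrable M Y"
    and "\<delta> > 0 \<Longrightarrow> \<exists>s. 0 < s \<and> s \<le> l \<and> expectation (\<lambda>x. exp (s * Y x)) < exp (s * (expectation Y + \<delta>))"
proof -
  \<comment> \<open>Staying below \<open>l / 2\<close> leaves a spare factor
    \<open>exp (l / 2 * \<bar>y\<bar>)\<close> that absorbs the \<open>\<bar>y\<bar>\<close> from
    \<open>exp_minus_one_bound\<close>, so one dominating function serves all n.\<close>
  define s where "s n = l / (2 * (1 + real n))" for n
  have s: "0 < s n" "s n \<le> l / 2" for n
    using l mult_left_mono[of 1 "1 + real n" "l"] by (auto simp: s_def field_simps)
  have s0: "s \<longlonglongrightarrow> 0"
    using tendsto_mult[OF tendsto_const[of "l / 2"] LIMSEQ_inverse_real_of_nat]
    by (simp add: s_def[abs_def] field_simps)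
  define g where "g = (\<lambda>x. 2 / l * (exp (l * Y x) + exp (- l * Y x)))"
  have g: "integrable M g"
    unfolding g_def using int by simp
  have bnd: "\<bar>(exp (s n * y) - 1) / s n\<bar> \<le> 2 / l * (exp (l * y) + exp (- l * y))" for n y
  proof -
    have "\<bar>(exp (s n * y) - 1) / s n\<bar> \<le> \<bar>s n * y\<bar> * exp \<bar>s n * y\<bar> / s n"
      using s(1)[of n] exp_minus_one_bound[of "s n * y"] by (simp add: divide_simps)
    also have "\<dots> = \<bar>y\<bar> * exp (s n * \<bar>y\<bar>)"
      using s(1)[of n] by (simp add: abs_mult)
    also have "\<dots> \<le> (2 / l * exp (l / 2 * \<bar>y\<bar>)) * exp (l / 2 * \<bar>y\<bar>)"
    proof (intro mult_mono)
      have "l / 2 * \<bar>y\<bar> \<le> exp (l / 2 * \<bar>y\<bar>)"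
        using exp_ge_add_one_self[of "l / 2 * \<bar>y\<bar>"] by linarith
      then show "\<bar>y\<bar> \<le> 2 / l * exp (l / 2 * \<bar>y\<bar>)"
        using l by (simp add: field_simps)
    qed (use mult_right_mono[OF s(2)[of n], of "\<bar>y\<bar>"] l in auto)
    also have "\<dots> = 2 / l * exp (l * \<bar>y\<bar>)"
      by (simp add: exp_add[symmetric])
    also have "\<dots> \<le> 2 / l * (exp (l * y) + exp (- l * y))"
    proof (rule mult_left_mono)
      show "exp (l * \<bar>y\<bar>) \<le> exp (l * y) + exp (- l * y)"
        by (cases "y \<ge> 0") auto
    qed (use l in simp)
    finally show ?thesis .
  qed
  have lim: "(\<lambda>n. (exp (s n * y) - 1) / s n) \<longlonglongrightarrow> y" for y
  proof -
    have "((\<lambda>h. (exp (h * y) - 1) / h) \<longlongrightarrow> y) (at 0)"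
    proof -
      have "((\<lambda>h. exp (h * y)) has_field_derivative y) (at 0)"
        by (auto intro!: derivative_eq_intros)
      then show ?thesis by (simp add: DERIV_def)
    qed
    then show ?thesis
      by (rule filterlim_compose) (rule filterlim_atI[OF s0], use s(1) in \<open>simp add: order_less_imp_not_eq2\<close>)
  qed
  \<comment> \<open>Y is the pointwise limit of the quotients, so its integrability is itself a
    conclusion of dominated convergence.\<close>
  have dom: "integrable M Y" "(\<lambda>n. expectation (\<lambda>x. (exp (s n * Y x) - 1) / s n)) \<longlonglongrightarrow> expectation Y"
  proof -
    have le_g: "AE x in M. norm ((exp (s n * Y x) - 1) / s n) \<le> g x" for n
      using bnd by (simp add: g_def del: times_divide_eq_left)
    have "AE x in M. (\<lambda>n. (exp (s n * Y x) - 1) / s n) \<longlonglongrightarrow> Y x"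
      by (simp add: lim)
    note dc = Y _ g this le_g
    show "integrable M Y"
      by (rule integrable_dominated_convergence[OF dc]) measurable
    show "(\<lambda>n. expectation (\<lambda>x. (exp (s n * Y x) - 1) / s n)) \<longlonglongrightarrow> expectation Y"
      by (rule integral_dominated_convergence[OF dc]) measurable
  qed
  show "integrable M Y" by fact
  assume "\<delta> > 0"
  then have "\<forall>\<^sub>F n in sequentially. expectation (\<lambda>x. (exp (s n * Y x) - 1) / s n) < expectation Y + \<delta>"
    using dom(2) by (intro order_tendstoD) auto
  then obtain n where n: "expectation (\<lambda>x. (exp (s n * Y x) - 1) / s n) < expectation Y + \<delta>"
    by (auto simp: eventually_sequentially)
  have int_s: "integrable M (\<lambda>x. exp (s n * Y x))"
    using s[of n] l by (intro exp_moments_imp_integrable[OF Y l int]) auto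
  have "(expectation (\<lambda>x. exp (s n * Y x)) - 1) / s n = expectation (\<lambda>x. (exp (s n * Y x) - 1) / s n)"
    using int_s by (simp add: prob_space)
  with n have "expectation (\<lambda>x. exp (s n * Y x)) < 1 + s n * (expectation Y + \<delta>)"
    using s[of n] by (simp add: field_simps)
  also have "\<dots> \<le> exp (s n * (expectation Y + \<delta>))" by (rule exp_ge_add_one_self)
  finally show "\<exists>s. 0 < s \<and> s \<le> l \<and> expectation (\<lambda>x. exp (s * Y x)) < exp (s * (expectation Y + \<delta>))"
    using s[of n] l by (intro exI[of _ "s n"]) auto
qed

text \<open>The quotient is the integral of \<open>exp (- u * t)\<close> over u in
  \<open>{p..q}\<close>; exchanging the integrals leaves the integral of
  \<open>1 / u\<close>.\<close>

lemma nn_integral_frullani: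
  fixes p q :: real
  assumes "0 < p" "p \<le> q"
  shows "(\<integral>\<^sup>+t. ennreal (indicator {0<..} t * ((exp (- t * p) - exp (- t * q)) / t)) \<partial>lborel) = ennreal (ln q - ln p)"
proof -
  define g :: "real \<Rightarrow> real \<Rightarrow> real" where
    "g t u = indicator {0<..} t * exp (- u * t) * indicator {p..q} u" for t u
  have [measurable]: "(\<lambda>(t, u). ennreal (g t u)) \<in> borel_measurable (lborel \<Otimes>\<^sub>M lborel)"
    unfolding g_def by measurable
  have "(\<integral>\<^sup>+u. ennreal (g t u) \<partial>lborel) =
      ennreal (indicator {0<..} t * ((exp (- t * p) - exp (- t * q)) / t))" for t
  proof (cases "t > 0")
    case True
    have "(\<integral>\<^sup>+u. ennreal (g t u) \<partial>lborel) = (\<integral>\<^sup>+u. ennreal (exp (- u * t)) * indicator {p..q} u \<partial>lborel)"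
      using True by (intro nn_integral_cong) (auto simp: g_def indicator_def)
    also have "\<dots> = ennreal (- exp (- q * t) / t - - exp (- p * t) / t)"
      using True assms
      by (intro nn_integral_FTC_Icc) (auto intro!: derivative_eq_intros)
    finally show ?thesis using True by (simp add: diff_divide_distrib mult.commute)
  qed (simp add: g_def)
  then have "(\<integral>\<^sup>+t. ennreal (indicator {0<..} t * ((exp (- t * p) - exp (- t * q)) / t)) \<partial>lborel) =
      (\<integral>\<^sup>+t. \<integral>\<^sup>+u. ennreal (g t u) \<partial>lborel \<partial>lborel)"
    by simp
  also have "\<dots> = (\<integral>\<^sup>+u. \<integral>\<^sup>+t. ennreal (g t u) \<partial>lborel \<partial>lborel)"
    by (intro lborel_pair.Fubini'[symmetric]) measurable
  also have "\<dots> = (\<integral>\<^sup>+u. ennreal (1 / u) * indicator {p..q} u \<partial>lborel)"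
  proof (intro nn_integral_cong)
    fix u
    show "(\<integral>\<^sup>+t. ennreal (g t u) \<partial>lborel) = ennreal (1 / u) * indicator {p..q} u"
    proof (cases "u \<in> {p..q}")
      case True
      have "(\<integral>\<^sup>+t. ennreal (g t u) \<partial>lborel) =
          (\<integral>\<^sup>+t. ennreal (indicator {0<..} t * (t powr (1 - 1) * exp (- u * t))) \<partial>lborel)"
        using True by (intro nn_integral_cong) (auto simp: g_def indicator_def)
      then show ?thesis
        using True assms nn_integral_Gamma[of 1 u] by (simp add: Gamma_1)
    qed (simp add: g_def)
  qed
  also have "\<dots> = ennreal (ln q - ln p)"
    using assms by (intro nn_integral_FTC_Icc) (auto intro!: derivative_eq_intros simp: divide_inverse)
  finally show ?thesis .
qed

text \<open>The integrand has constant sign in t, determined by the sign of y, so its absolute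
  integral is \<open>\<bar>y\<bar>\<close>. This second part makes joint integrability in the next
  lemma follow from that of Y.\<close>

lemma frullani_exp:
  fixes y :: real
  defines "f \<equiv> \<lambda>t. indicator {0<..} t * ((exp (- t) - exp (- t * exp y)) / t)"
  shows "has_bochner_integral lborel f y" "(LINT t|lborel. \<bar>f t\<bar>) = \<bar>y\<bar>"
proof -
  have nn1: "has_bochner_integral lborel f y \<and> (LINT t|lborel. \<bar>f t\<bar>) = \<bar>y\<bar>" if "y \<ge> 0"
  proof -
    have nn: "f t \<ge> 0" for t
      using that mult_left_mono[of 1 "exp y" t] by (auto simp: f_def indicator_def)
    have "has_bochner_integral lborel f y"
      using nn that nn_integral_frullani[of 1 "exp y"]
      by (intro has_bochner_integral_nn_integral) (auto simp: f_def)
    then show ?thesis using nn that by (simp add: has_bochner_integral_iff)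
  qed
  have nn2: "has_bochner_integral lborel f y \<and> (LINT t|lborel. \<bar>f t\<bar>) = \<bar>y\<bar>" if "y < 0"
  proof -
    have nn: "- f t \<ge> 0" for t
      using that mult_left_mono[of "exp y" 1 t] by (auto simp: f_def indicator_def divide_le_0_iff)
    have neg: "- f t = indicator {0<..} t * ((exp (- t * exp y) - exp (- t)) / t)" for t
      by (simp add: f_def algebra_simps diff_divide_distrib)
    have "has_bochner_integral lborel (\<lambda>t. - f t) (- y)"
    proof (rule has_bochner_integral_nn_integral)
      show "(\<integral>\<^sup>+t. ennreal (- f t) \<partial>lborel) = ennreal (- y)"
        unfolding neg using that nn_integral_frullani[of "exp y" 1] by simp
    qed (use nn that in \<open>auto simp: f_def\<close>)
    then show ?thesis using nn that
      has_bochner_integral_minus[of lborel "\<lambda>t. - f t" "- y"]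
      by (simp add: has_bochner_integral_iff)
  qed
  show "has_bochner_integral lborel f y" "(LINT t|lborel. \<bar>f t\<bar>) = \<bar>y\<bar>"
    using nn1 nn2 by force+
qed

text \<open>Fubini for \<open>frullani_exp\<close> at \<open>y = Y x\<close>. For fixed t > 0 the
  expectation may be taken inside, as \<open>exp (- t * exp (Y x))\<close> is bounded by 1.\<close>

lemma (in prob_space) expectation_eq_laplace_integral:
  fixes Y :: "'a \<Rightarrow> real"
  assumes Y: "integrable M Y"
  shows "has_bochner_integral (restrict_space lborel {0<..})
      (\<lambda>t. (exp (- t) - expectation (\<lambda>x. exp (- t * exp (Y x)))) / t) (expectation Y)"
proof -
  interpret P: pair_sigma_finite M "lborel :: real measure" ..
  have [measurable]: "Y \<in> borel_measurable M" using Y by simp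
  define f where "f x t = indicator {0<..} t * ((exp (- t) - exp (- t * exp (Y x))) / t)" for x t
  have [measurable]: "case_prod f \<in> borel_measurable (M \<Otimes>\<^sub>M lborel)"
    unfolding f_def by measurable
  note fr = frullani_exp[of "Y x" for x, folded f_def]
  have int: "integrable (M \<Otimes>\<^sub>M lborel) (case_prod f)"
    by (rule P.Fubini_integrable) (use fr Y in \<open>auto simp: has_bochner_integral_iff\<close>)
  have inner: "expectation (\<lambda>x. f x t) = indicator {0<..} t *\<^sub>R ((exp (- t) - expectation (\<lambda>x. exp (- t * exp (Y x)))) / t)" for t
  proof (cases "t > 0")
    case True
    have "integrable M (\<lambda>x. exp (- t * exp (Y x)))"
      using True by (intro integrable_const_bound[of _ 1]) auto
    then show ?thesis using True by (simp add: f_def prob_space)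
  qed (simp add: f_def)
  have "has_bochner_integral lborel (\<lambda>t. expectation (\<lambda>x. f x t)) (expectation Y)"
    using P.integrable_snd[OF int] P.Fubini_integral[OF int] fr
    by (simp add: has_bochner_integral_iff)
  then show ?thesis
    unfolding inner by (subst has_bochner_integral_restrict_space) simp_all
qed

section \<open>The law of a row product\<close>

text \<open>Right multiplication by z scales norms by \<open>norm z\<close>; polarisation carries
  this over to inner products.\<close>

lemma inner_mult_right_same:
  fixes x y z :: "'a::{real_inner, real_normed_div_algebra}"
  shows "(x * z) \<bullet> (y * z) = (norm z)\<^sup>2 * (x \<bullet> y)"
  unfolding dot_norm distrib_right[symmetric] norm_mult power_mult_distrib by (simp add: field_simps)

text \<open>Taken as a map of the row x with v fixed. The entries of x stand on the left, as in a
  matrix-vector product; for quaternions the order matters.\<close>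

definition vec_dot :: "'a::real_normed_div_algebra^'n \<Rightarrow> 'a^'n \<Rightarrow> 'a" where
  "vec_dot v x = (\<Sum>j\<in>UNIV. x $ j * v $ j)"

text \<open>The factor \<open>(norm (v $ j))\<^sup>2 *\<^sub>R inverse (v $ j)\<close> is the
  conjugate of \<open>v $ j\<close>, written so that it makes sense in all three number systems; it
  is 0 when \<open>v $ j\<close> is 0.\<close>

definition vec_dot_adjoint :: "'a::real_normed_div_algebra^'n \<Rightarrow> 'a \<Rightarrow> 'a^'n" where
  "vec_dot_adjoint v g = (\<chi> j. (norm (v $ j))\<^sup>2 *\<^sub>R (g * inverse (v $ j)))"

lemma inner_vec_dot:
  fixes v x :: "'a::{real_inner, real_normed_div_algebra}^'n"
  shows "vec_dot v x \<bullet> g = x \<bullet> vec_dot_adjoint v g"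
proof -
  have "(x $ j * v $ j) \<bullet> g = x $ j \<bullet> ((norm (v $ j))\<^sup>2 *\<^sub>R (g * inverse (v $ j)))" for j
  proof (cases "v $ j = 0")
    case False
    then have "(x $ j * v $ j) \<bullet> g = (x $ j * v $ j) \<bullet> (g * inverse (v $ j) * v $ j)"
      by (simp add: mult.assoc)
    then show ?thesis by (simp add: inner_mult_right_same)
  qed simp
  then show ?thesis by (simp add: vec_dot_def vec_dot_adjoint_def inner_vec_def inner_sum_left)
qed

lemma norm_vec_power2: "(norm (x :: 'a::real_normed_vector^'n))\<^sup>2 = (\<Sum>j\<in>UNIV. (norm (x $ j))\<^sup>2)"
  by (simp add: norm_vec_def L2_set_def sum_nonneg)

lemma norm_vec_dot_adjoint: "norm (vec_dot_adjoint v g) = norm v * norm g"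
proof -
  have "norm ((norm (v $ j))\<^sup>2 *\<^sub>R (g * inverse (v $ j))) = norm (v $ j) * norm g" for j
    by (cases "v $ j = 0") (simp_all add: norm_mult norm_inverse power2_eq_square)
  then have "(norm (vec_dot_adjoint v g))\<^sup>2 = (norm v * norm g)\<^sup>2"
    by (simp add: norm_vec_power2 vec_dot_adjoint_def power_mult_distrib sum_distrib_right)
  then show ?thesis by (simp add: power2_eq_iff_nonneg)
qed

lemma continuous_vec_dot: "continuous_on UNIV (vec_dot v)"
  unfolding vec_dot_def by (intro continuous_intros)

lemma matrix_vector_mult_row: "(A *v v) $ l = vec_dot v (row l A)"
  by (simp add: matrix_vector_mult_def vec_dot_def row_def)

text \<open>A reference space for the variable S: coordinate l has the law of the squared l-th entry
  of \<open>X v\<close> for a unit vector v.\<close>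

definition beta_prime_product :: "nat \<Rightarrow> ('n \<Rightarrow> real) \<Rightarrow> ('n \<Rightarrow> real) measure" where
  "beta_prime_product \<beta> \<omega> = (\<Pi>\<^sub>M l\<in>UNIV. density lborel (\<lambda>s. ennreal (beta_prime_density (\<beta> / 2) (\<omega> l / 2) s)))"

text \<open>The absolute value only serves to make the sum nonnegative off the support.\<close>

definition abs_sum :: "('n::finite \<Rightarrow> real) \<Rightarrow> real" where
  "abs_sum r = (\<Sum>l\<in>UNIV. \<bar>r l\<bar>)"

text \<open>Here \<beta> is any positive integer; it becomes \<open>DIM('a)\<close> once matrices
  appear.\<close>

locale beta_prime_weights =
  fixes \<beta> :: nat and \<omega> :: "'n::finite \<Rightarrow> real"
  assumes \<beta>_pos: "\<beta> > 0" and \<omega>_pos: "\<And>l. \<omega> l > 0"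
begin

abbreviation "Q \<equiv> beta_prime_product \<beta> \<omega>"

sublocale marg: prob_space "density lborel (\<lambda>s. ennreal (beta_prime_density (\<beta> / 2) (\<omega> l / 2) s))" for l
  using \<beta>_pos \<omega>_pos by (intro prob_space_beta_prime) auto

sublocale prod: product_prob_space "\<lambda>l. density lborel (\<lambda>s. ennreal (beta_prime_density (\<beta> / 2) (\<omega> l / 2) s))" UNIV
  by standard

sublocale Q: prob_space Q
  unfolding beta_prime_product_def by (rule prod.prob_space_axioms)

lemma sets_Q [measurable_cong]: "sets Q = sets (\<Pi>\<^sub>M l\<in>UNIV. borel)"
  unfolding beta_prime_product_def by (intro sets_PiM_cong) auto

lemma measurable_abs_sum [measurable]: "abs_sum \<in> borel_measurable Q"
  unfolding abs_sum_def by measurable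

lemma nn_integral_component:
  assumes [measurable]: "f \<in> borel_measurable borel"
  shows "(\<integral>\<^sup>+r. f (r l) \<partial>Q) = (\<integral>\<^sup>+s. ennreal (beta_prime_density (\<beta> / 2) (\<omega> l / 2) s) * f s \<partial>lborel)"
proof -
  have "(\<integral>\<^sup>+r. f (r l) \<partial>Q) = (\<integral>\<^sup>+s. f s \<partial>distr Q borel (\<lambda>r. r l))"
    by (subst nn_integral_distr) simp_all
  also have "distr Q borel (\<lambda>r. r l) = distr Q (density lborel (\<lambda>s. ennreal (beta_prime_density (\<beta> / 2) (\<omega> l / 2) s))) (\<lambda>r. r l)"
    by (intro distr_cong) auto
  also have "\<dots> = density lborel (\<lambda>s. ennreal (beta_prime_density (\<beta> / 2) (\<omega> l / 2) s))"
    unfolding beta_prime_product_def by (rule prod.PiM_component) simp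
  finally show ?thesis by (simp add: nn_integral_density)
qed

lemma AE_component_pos: "AE r in Q. r l > 0"
proof -
  have "(\<integral>\<^sup>+r. indicator {..0} (r l) \<partial>Q) = (\<integral>\<^sup>+s. ennreal (beta_prime_density (\<beta> / 2) (\<omega> l / 2) s) * indicator {..0} s \<partial>lborel)"
    by (intro nn_integral_component) measurable
  also have "\<dots> = 0"
    by (intro nn_integral_zero') (auto simp: beta_prime_density_def indicator_def)
  finally have "AE r in Q. indicator {..0} (r l) = (0::ennreal)"
    by (subst (asm) nn_integral_0_iff_AE) auto
  then show ?thesis by eventually_elim (auto simp: indicator_def split: if_splits)
qed

lemma AE_abs_sum_pos: "AE r in Q. abs_sum r > 0"
  \<comment> \<open>\<open>undefined\<close> is just some index: one positive coordinate makes the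
    sum positive.\<close>
  using AE_component_pos[of undefined]
  by eventually_elim (auto simp: abs_sum_def intro!: sum_pos2[of _ undefined])

lemma laplace_abs_sum:
  assumes "t \<ge> 0"
  shows "(\<integral>\<^sup>+r. ennreal (exp (- t * abs_sum r)) \<partial>Q) =
    (\<Prod>l\<in>UNIV. \<integral>\<^sup>+s. ennreal (beta_prime_density (\<beta> / 2) (\<omega> l / 2) s) * ennreal (exp (- t * s)) \<partial>lborel)"
proof -
  have "(\<integral>\<^sup>+r. ennreal (exp (- t * abs_sum r)) \<partial>Q) = (\<integral>\<^sup>+r. (\<Prod>l\<in>UNIV. ennreal (exp (- t * \<bar>r l\<bar>))) \<partial>Q)"
    by (simp add: abs_sum_def sum_distrib_left exp_sum[symmetric] prod_ennreal sum_negf)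
  also have "\<dots> = (\<Prod>l\<in>UNIV. \<integral>\<^sup>+s. ennreal (exp (- t * \<bar>s\<bar>)) \<partial>density lborel (\<lambda>s. ennreal (beta_prime_density (\<beta> / 2) (\<omega> l / 2) s)))"
    unfolding beta_prime_product_def by (intro prod.product_nn_integral_prod) auto
  also have "\<dots> = (\<Prod>l\<in>UNIV. \<integral>\<^sup>+s. ennreal (beta_prime_density (\<beta> / 2) (\<omega> l / 2) s) * ennreal (exp (- t * s)) \<partial>lborel)"
    by (intro prod.cong refl) (auto simp: nn_integral_density beta_prime_density_def indicator_def intro!: nn_integral_cong)
  finally show ?thesis .
qed

end

text \<open>By independence of the rows the Laplace transform factors; each factor is
  \<open>beta_II_laplace\<close> for \<open>vec_dot v\<close> with \<open>c = norm v\<close>, and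
  the product is the transform of \<open>abs_sum\<close> at
  \<open>t * (norm v)\<^sup>2\<close>.\<close>

lemma distr_norm_matrix_vector_mult:
  fixes X :: "'w \<Rightarrow> ('a::{euclidean_space, real_normed_div_algebra})^'n^'n"
  assumes M: "prob_space M" and rows: "beta_II_rows M \<omega> X" and \<omega>: "\<And>l. \<omega> l > 0"
    and X [measurable]: "X \<in> borel_measurable M"
  shows "distr M borel (\<lambda>w. (norm (X w *v v))\<^sup>2) =
    distr (beta_prime_product DIM('a) \<omega>) borel (\<lambda>r. (norm v)\<^sup>2 * abs_sum r)"
proof -
  interpret M: prob_space M by fact
  interpret beta_prime_weights "DIM('a)" \<omega> by standard (use \<omega> in auto)
  have vd [measurable]: "vec_dot v \<in> borel_measurable borel"
    by (intro borel_measurable_continuous_onI continuous_vec_dot)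
  have row [measurable]: "(\<lambda>w. row l (X w)) \<in> borel_measurable M" for l
    using rows by (auto simp: beta_II_rows_def distributed_def)
  have nrm: "(norm (X w *v v))\<^sup>2 = (\<Sum>l\<in>UNIV. (norm (vec_dot v (row l (X w))))\<^sup>2)" for w
    by (simp add: norm_vec_power2 matrix_vector_mult_row)
  have indep: "M.indep_vars (\<lambda>_. borel) (\<lambda>l w. ennreal (exp (- t * (norm (vec_dot v (row l (X w))))\<^sup>2))) UNIV" for t
    using rows M.indep_vars_compose2[of "\<lambda>_. borel" "\<lambda>l w. row l (X w)" UNIV "\<lambda>_ x. ennreal (exp (- t * (norm (vec_dot v x))\<^sup>2))" "\<lambda>_. borel"]
    by (auto simp: beta_II_rows_def)
  show ?thesis
  proof (rule distr_eqI_laplace)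
    fix t :: real assume t: "t > 0"
    have "(\<integral>\<^sup>+w. ennreal (exp (- t * (norm (X w *v v))\<^sup>2)) \<partial>M) =
        (\<integral>\<^sup>+w. (\<Prod>l\<in>UNIV. ennreal (exp (- t * (norm (vec_dot v (row l (X w))))\<^sup>2))) \<partial>M)"
      by (simp add: nrm sum_distrib_left exp_sum[symmetric] prod_ennreal sum_negf)
    also have "\<dots> = (\<Prod>l\<in>UNIV. \<integral>\<^sup>+w. ennreal (exp (- t * (norm (vec_dot v (row l (X w))))\<^sup>2)) \<partial>M)"
      by (intro M.indep_vars_nn_integral indep) auto
    also have "\<dots> = (\<Prod>l\<in>UNIV. \<integral>\<^sup>+s. ennreal (beta_prime_density (DIM('a) / 2) (\<omega> l / 2) s) *
        ennreal (exp (- (t * (norm v)\<^sup>2) * s)) \<partial>lborel)"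
    proof (intro prod.cong refl)
      fix l
      have "distributed M lborel (\<lambda>w. row l (X w)) (\<lambda>x. ennreal (beta_II_density (\<omega> l) x))"
        using rows by (simp add: beta_II_rows_def)
      then have "(\<integral>\<^sup>+w. ennreal (exp (- t * (norm (vec_dot v (row l (X w))))\<^sup>2)) \<partial>M) =
          (\<integral>\<^sup>+x. ennreal (beta_II_density (\<omega> l) x) * ennreal (exp (- t * (norm (vec_dot v x))\<^sup>2)) \<partial>lborel)"
        by (intro distributed_nn_integral[symmetric]) auto
      also have "\<dots> = (\<integral>\<^sup>+s. ennreal (beta_prime_density (DIM('a) / 2) (\<omega> l / 2) s) *
        ennreal (exp (- (t * (norm v)\<^sup>2) * s)) \<partial>lborel)"
        using beta_II_laplace[OF \<omega> t vd inner_vec_dot norm_vec_dot_adjoint, of l]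
        by (simp add: beta_II_density_def Let_def mult.commute)
      finally show "(\<integral>\<^sup>+w. ennreal (exp (- t * (norm (vec_dot v (row l (X w))))\<^sup>2)) \<partial>M) =
        (\<integral>\<^sup>+s. ennreal (beta_prime_density (DIM('a) / 2) (\<omega> l / 2) s) *
        ennreal (exp (- (t * (norm v)\<^sup>2) * s)) \<partial>lborel)" .
    qed
    also have "\<dots> = (\<integral>\<^sup>+r. ennreal (exp (- (t * (norm v)\<^sup>2) * abs_sum r)) \<partial>Q)"
      using t by (intro laplace_abs_sum[symmetric]) simp
    finally show "(\<integral>\<^sup>+w. ennreal (exp (- t * (norm (X w *v v))\<^sup>2)) \<partial>M) =
        (\<integral>\<^sup>+r. ennreal (exp (- t * ((norm v)\<^sup>2 * abs_sum r))) \<partial>Q)"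
      by (simp add: mult.assoc)
  qed (use M in \<open>auto simp: nrm abs_sum_def sum_nonneg intro!: Q.prob_space_axioms\<close>)
qed

section \<open>Growth from moments\<close>

text \<open>Normalised by \<open>exp (- a * real m)\<close>, the means form a geometric series with
  ratio \<open>q < 1\<close>. The random series thus has finite expectation, converges almost
  surely, and its terms tend to 0.\<close>

lemma (in prob_space) AE_eventually_less_exp:
  fixes W :: "nat \<Rightarrow> 'a \<Rightarrow> real"
  assumes W [measurable]: "\<And>m. W m \<in> borel_measurable M" and nn: "\<And>m x. W m x \<ge> 0"
    and c: "0 \<le> c" "c < exp a" and K: "K \<ge> 0"
    and mean: "\<And>m. (\<integral>\<^sup>+x. ennreal (W m x) \<partial>M) = ennreal (c ^ m * K)"
  shows "AE x in M. \<forall>\<^sub>F m in sequentially. W m x < exp (a * real m)"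
proof -
  define q where "q = c * exp (- a)"
  have q: "0 \<le> q" "q < 1" using c by (auto simp: q_def exp_minus field_simps)
  have e: "exp (- (a * real m)) = exp (- a) ^ m" for m
    by (simp add: exp_of_nat_mult[symmetric] mult.commute)
  have mean_q: "(\<integral>\<^sup>+x. ennreal (W m x * exp (- a * real m)) \<partial>M) = ennreal (q ^ m * K)" for m
  proof -
    have "(\<integral>\<^sup>+x. ennreal (W m x * exp (- a * real m)) \<partial>M) = ennreal (c ^ m * K) * ennreal (exp (- a * real m))"
      using nn by (simp add: ennreal_mult nn_integral_multc mean)
    then show ?thesis
      using c K by (simp add: ennreal_mult[symmetric] e q_def power_mult_distrib mult_ac)
  qed
  have "(\<integral>\<^sup>+x. (\<Sum>m. ennreal (W m x * exp (- a * real m))) \<partial>M) = (\<Sum>m. \<integral>\<^sup>+x. ennreal (W m x * exp (- a * real m)) \<partial>M)"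
    by (intro nn_integral_suminf) measurable
  also have "\<dots> = ennreal (\<Sum>m. q ^ m * K)"
    unfolding mean_q using q K by (intro suminf_ennreal2 summable_mult2 summable_geometric) auto
  finally have "AE x in M. (\<Sum>m. ennreal (W m x * exp (- a * real m))) \<noteq> \<infinity>"
    by (intro nn_integral_noteq_infinite) auto
  then show ?thesis
  proof eventually_elim
    case (elim x)
    have "summable (\<lambda>m. W m x * exp (- a * real m))"
      using elim nn by (intro summable_suminf_not_top) auto
    then have "(\<lambda>m. W m x * exp (- a * real m)) \<longlonglongrightarrow> 0"
      by (rule summable_LIMSEQ_zero)
    then have "\<forall>\<^sub>F m in sequentially. W m x * exp (- a * real m) < 1"
      by (rule order_tendstoD) simp
    then show ?case by eventually_elim (simp add: exp_minus field_simps)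
  qed
qed

text \<open>A law of large numbers from the moments of each single \<open>Z m\<close>: no joint law
  of the sequence enters, since exponentially small tails already give almost sure bounds.\<close>

lemma (in prob_space) AE_log_growth:
  fixes Z :: "nat \<Rightarrow> 'a \<Rightarrow> real" and Y :: "'b \<Rightarrow> real"
  assumes Z [measurable]: "\<And>m. Z m \<in> borel_measurable M" and pos: "AE x in M. \<forall>m. Z m x > 0"
    and Q: "prob_space Q" and Y [measurable]: "Y \<in> borel_measurable Q" and l: "l > 0"
    and int: "integrable Q (\<lambda>r. exp (l * Y r))" "integrable Q (\<lambda>r. exp (- l * Y r))"
    and z: "z > 0"
    and mean: "\<And>s m. \<bar>s\<bar> \<le> l \<Longrightarrow>
      (\<integral>\<^sup>+x. ennreal (Z m x powr s) \<partial>M) = ennreal ((LINT r|Q. exp (s * Y r)) ^ m * z powr s)"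
  shows "AE x in M. (\<lambda>m. ln (Z m x) / real m) \<longlonglongrightarrow> integral\<^sup>L Q Y"
proof -
  interpret Q: prob_space Q by fact
  define \<mu> where "\<mu> = integral\<^sup>L Q Y"
  \<comment> \<open>\<sigma> = 1 yields the upper bound and \<sigma> = -1 the lower one; the tangent
    estimate is applied to \<open>\<sigma> * Y\<close>, and \<open>s * \<sigma>\<close> stays in the
    range covered by \<open>mean\<close>.\<close>
  have bound: "AE x in M. \<forall>\<^sub>F m in sequentially. \<sigma> * (ln (Z m x) / real m) < \<sigma> * \<mu> + \<delta>"
    if \<sigma>: "\<sigma> = 1 \<or> \<sigma> = -1" and \<delta>: "\<delta> > 0" for \<sigma> \<delta> :: real
  proof -
    have "\<exists>s. 0 < s \<and> s \<le> l \<and> (LINT r|Q. exp (s * (\<sigma> * Y r))) < exp (s * ((LINT r|Q. \<sigma> * Y r) + \<delta>))"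
      using \<sigma> int by (intro Q.exp_moment_tangent(2)[OF _ l _ _ \<delta>]) auto
    then obtain s where s: "0 < s" "s \<le> l" "(LINT r|Q. exp (s * \<sigma> * Y r)) < exp (s * (\<sigma> * \<mu> + \<delta>))"
      by (auto simp: \<mu>_def mult.assoc)
    have "AE x in M. \<forall>\<^sub>F m in sequentially. Z m x powr (s * \<sigma>) < exp (s * (\<sigma> * \<mu> + \<delta>) * real m)"
    proof (rule AE_eventually_less_exp)
      show "(\<integral>\<^sup>+x. ennreal (Z m x powr (s * \<sigma>)) \<partial>M) =
          ennreal ((LINT r|Q. exp (s * \<sigma> * Y r)) ^ m * z powr (s * \<sigma>))" for m
        using s \<sigma> by (intro mean) auto
    qed (use s in \<open>auto intro!: integral_nonneg_AE\<close>)
    with pos show ?thesis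
    proof eventually_elim
      case (elim x)
      from elim(2) eventually_gt_at_top[of 0] show ?case
      proof eventually_elim
        case (elim m)
        have "exp (s * \<sigma> * ln (Z m x)) < exp (s * (\<sigma> * \<mu> + \<delta>) * real m)"
          using elim(1) \<open>\<forall>m. Z m x > 0\<close>[rule_format, of m] by (simp add: powr_def)
        then have "s * (\<sigma> * ln (Z m x)) < s * ((\<sigma> * \<mu> + \<delta>) * real m)"
          by (simp add: mult.assoc)
        then have "\<sigma> * ln (Z m x) < (\<sigma> * \<mu> + \<delta>) * real m"
          using s by (simp only: mult_less_cancel_left_pos)
        then show ?case using elim(2) by (simp add: field_simps)
      qed
    qed
  qed
  \<comment> \<open>Countably many tolerances, so that a single null set serves all of them.\<close>
  have "AE x in M. \<forall>k::nat. \<forall>\<^sub>F m in sequentially. ln (Z m x) / real m < \<mu> + 1 / Suc k"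
    using bound[of 1 "1 / Suc k" for k] by (subst AE_all_countable) auto
  moreover have "AE x in M. \<forall>k::nat. \<forall>\<^sub>F m in sequentially. - (ln (Z m x) / real m) < - \<mu> + 1 / Suc k"
    using bound[of "-1" "1 / Suc k" for k] by (subst AE_all_countable) auto
  ultimately show ?thesis
  proof eventually_elim
    case (elim x)
    show ?case unfolding \<mu>_def[symmetric]
    proof (rule tendstoI)
      fix e :: real assume "e > 0"
      then obtain k where k: "1 / Suc k < e" using nat_approx_posE by blast
      from elim(1)[rule_format, of k] elim(2)[rule_format, of k]
      show "\<forall>\<^sub>F m in sequentially. dist (ln (Z m x) / real m) \<mu> < e"
        by eventually_elim (use k in \<open>auto simp: dist_real_def abs_less_iff\<close>)
    qed
  qed
qed

section \<open>Moments and Laplace transform of the sum\<close>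

context beta_prime_weights
begin

definition log_sum :: "('n \<Rightarrow> real) \<Rightarrow> real" where
  "log_sum r = ln (abs_sum r)"

lemma measurable_log_sum [measurable]: "log_sum \<in> borel_measurable Q"
  unfolding log_sum_def by measurable

lemma AE_exp_log_sum: "AE r in Q. exp (s * log_sum r) = abs_sum r powr s"
  using AE_abs_sum_pos by eventually_elim (simp add: log_sum_def powr_def)

lemma nn_integral_component_powr:
  "(\<integral>\<^sup>+r. ennreal (\<bar>r l\<bar> powr p) \<partial>Q) = (\<integral>\<^sup>+s. ennreal (beta_prime_density (\<beta> / 2) (\<omega> l / 2) s) * ennreal (s powr p) \<partial>lborel)"
  by (subst nn_integral_component)
     (auto simp: beta_prime_density_def indicator_def intro!: nn_integral_cong)

text \<open>The sum is at most N times its largest term, which treats exponents below and above 1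
  alike.\<close>

lemma abs_sum_powr_le:
  fixes r :: "'n \<Rightarrow> real"
  assumes "p \<ge> 0"
  shows "abs_sum r powr p \<le> real CARD('n) powr p * (\<Sum>l\<in>UNIV. \<bar>r l\<bar> powr p)"
proof -
  define b where "b = Max (range (\<lambda>l. \<bar>r l\<bar>))"
  have "b \<in> range (\<lambda>l. \<bar>r l\<bar>)"
    unfolding b_def by (rule Max_in) auto
  then obtain k where k: "b = \<bar>r k\<bar>" by auto
  have "abs_sum r \<le> real CARD('n) * b"
    using sum_bounded_above[of UNIV "\<lambda>l. \<bar>r l\<bar>" b] by (simp add: abs_sum_def b_def)
  then have "abs_sum r powr p \<le> (real CARD('n) * b) powr p"
    using assms by (intro powr_mono2) (auto simp: abs_sum_def sum_nonneg)
  also have "\<dots> = real CARD('n) powr p * \<bar>r k\<bar> powr p"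
    by (simp add: k powr_mult)
  also have "\<dots> \<le> real CARD('n) powr p * (\<Sum>l\<in>UNIV. \<bar>r l\<bar> powr p)"
    by (intro mult_left_mono member_le_sum) auto
  finally show ?thesis .
qed

lemma exp_moments_log_sum:
  obtains p where "p > 0" "integrable Q (\<lambda>r. exp (p * log_sum r))" "integrable Q (\<lambda>r. exp (- p * log_sum r))"
proof -
  \<comment> \<open>Order p needs \<open>p < \<omega> l / 2\<close> and order -p needs
    \<open>p < \<beta> / 2\<close>; a quarter of the minimum satisfies both for every l.\<close>
  define p where "p = Min (insert (real \<beta>) (range \<omega>)) / 4"
  have Min: "Min (insert (real \<beta>) (range \<omega>)) > 0"
    using \<omega>_pos \<beta>_pos by (subst Min_gr_iff) auto
  then have p: "p > 0" by (simp add: p_def)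
  have le: "Min (insert (real \<beta>) (range \<omega>)) \<le> real \<beta>" "Min (insert (real \<beta>) (range \<omega>)) \<le> \<omega> l" for l
    by (rule Min_le; simp)+
  have p_less: "p < \<beta> / 2" "p < \<omega> l / 2" for l
    using le(1) le(2)[of l] Min unfolding p_def by linarith+
  have fin: "(\<integral>\<^sup>+r. ennreal (\<bar>r l\<bar> powr p) \<partial>Q) < \<infinity>" "(\<integral>\<^sup>+r. ennreal (\<bar>r l\<bar> powr (- p)) \<partial>Q) < \<infinity>" for l
    using p p_less p_less(2)[of l] \<beta>_pos \<omega>_pos[of l] unfolding nn_integral_component_powr
    by (intro beta_prime_moment_finite; simp)+
  show thesis
  proof
    show "p > 0" by fact
    show "integrable Q (\<lambda>r. exp (p * log_sum r))"
    proof (rule integrableI_bounded)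
      have "(\<integral>\<^sup>+r. ennreal (norm (exp (p * log_sum r))) \<partial>Q) \<le>
          (\<integral>\<^sup>+r. ennreal (real CARD('n) powr p) * (\<Sum>l\<in>UNIV. ennreal (\<bar>r l\<bar> powr p)) \<partial>Q)"
      proof (rule nn_integral_mono_AE)
        show "AE r in Q. ennreal (norm (exp (p * log_sum r))) \<le>
            ennreal (real CARD('n) powr p) * (\<Sum>l\<in>UNIV. ennreal (\<bar>r l\<bar> powr p))"
          using AE_exp_log_sum[of p]
        proof eventually_elim
          case (elim r)
          then show ?case
            using abs_sum_powr_le[of p r] p
            by (simp add: sum_ennreal ennreal_mult[symmetric] sum_nonneg ennreal_leI)
        qed
      qed
      also have "\<dots> = ennreal (real CARD('n) powr p) * (\<Sum>l\<in>UNIV. \<integral>\<^sup>+r. ennreal (\<bar>r l\<bar> powr p) \<partial>Q)"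
        by (simp add: nn_integral_cmult nn_integral_sum del: sum_ennreal)
      also have "\<dots> < \<infinity>"
        using fin by (auto simp: ennreal_mult_less_top less_top)
      finally show "(\<integral>\<^sup>+r. ennreal (norm (exp (p * log_sum r))) \<partial>Q) < \<infinity>" .
    qed measurable
    show "integrable Q (\<lambda>r. exp (- p * log_sum r))"
    proof (rule integrableI_bounded)
      \<comment> \<open>For a negative exponent one coordinate suffices as a bound, since the sum is
        at least that coordinate.\<close>
      have "(\<integral>\<^sup>+r. ennreal (norm (exp (- p * log_sum r))) \<partial>Q) \<le>
          (\<integral>\<^sup>+r. ennreal (\<bar>r undefined\<bar> powr (- p)) \<partial>Q)"
      proof (rule nn_integral_mono_AE)
        show "AE r in Q. ennreal (norm (exp (- p * log_sum r))) \<le> ennreal (\<bar>r undefined\<bar> powr (- p))"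
          using AE_exp_log_sum[of "- p"] AE_component_pos[of undefined]
        proof eventually_elim
          case (elim r)
          have "\<bar>r undefined\<bar> \<le> abs_sum r"
            unfolding abs_sum_def by (rule member_le_sum) auto
          then show ?case
            using elim p by (auto intro!: ennreal_leI powr_mono2')
        qed
      qed
      also have "\<dots> < \<infinity>" by (rule fin)
      finally show "(\<integral>\<^sup>+r. ennreal (norm (exp (- p * log_sum r))) \<partial>Q) < \<infinity>" .
    qed measurable
  qed
qed

text \<open>Up to Gamma factors the Laplace integral of the density is the integral defining
  \<open>tricomi_U\<close>. Integrability is checked because that definition uses the Bochner
  integral.\<close>

lemma beta_prime_laplace_tricomi:
  assumes "t > 0"
  shows "(\<integral>\<^sup>+s. ennreal (beta_prime_density (\<beta> / 2) (\<omega> l / 2) s) * ennreal (exp (- t * s)) \<partial>lborel) =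
    ennreal (Gamma ((\<omega> l + real \<beta>) / 2) / Gamma (\<omega> l / 2) * tricomi_U (real \<beta> / 2) (1 - \<omega> l / 2) t)"
proof -
  define a where "a = real \<beta> / 2"
  define b where "b = \<omega> l / 2"
  have ab: "a > 0" "b > 0" using \<beta>_pos \<omega>_pos by (auto simp: a_def b_def)
  have nn: "beta_prime_density a b s \<ge> 0" for s by (rule beta_prime_density_nonneg[OF ab])
  have "(\<integral>\<^sup>+s. ennreal (beta_prime_density a b s) * ennreal (exp (- t * s)) \<partial>lborel) =
    (\<integral>\<^sup>+s. ennreal (beta_prime_density a b s * exp (- t * s)) \<partial>lborel)"
    using nn by (simp add: ennreal_mult)
  also have "\<dots> = ennreal (LINT s|lborel. beta_prime_density a b s * exp (- t * s))"
  proof (rule nn_integral_eq_integral)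
    show "integrable lborel (\<lambda>s. beta_prime_density a b s * exp (- t * s))"
    proof (rule Bochner_Integration.integrable_bound)
      show "integrable lborel (beta_prime_density a b)"
        using nn_integral_beta_prime_density[OF ab] nn by (intro integrableI_nonneg) auto
      show "AE s in lborel. norm (beta_prime_density a b s * exp (- t * s)) \<le> norm (beta_prime_density a b s)"
      proof (intro AE_I2)
        fix s
        show "norm (beta_prime_density a b s * exp (- t * s)) \<le> norm (beta_prime_density a b s)"
        proof (cases "s > 0")
          case True
          then show ?thesis
            using assms nn[of s] mult_left_le[of "exp (- t * s)" "beta_prime_density a b s"] by (simp add: abs_mult)
        qed (simp add: beta_prime_density_def)
      qed
    qed measurable
  qed (use nn in auto)
  also have "(LINT s|lborel. beta_prime_density a b s * exp (- t * s)) =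
     (LINT s|lborel. Gamma (a + b) / (Gamma a * Gamma b) *
        (indicator {0<..} s *\<^sub>R (exp (- t * s) * s powr (a - 1) * (1 + s) powr ((1 - b) - a - 1))))"
  proof -
    \<comment> \<open>This identity of exponents forces the second parameter
      \<open>1 - \<omega> l / 2\<close> of Tricomi's function.\<close>
    have "- (a + b) = (1 - b) - a - 1" by simp
    then show ?thesis
      by (intro Bochner_Integration.integral_cong) (simp_all only: beta_prime_density_def real_scaleR_def mult_ac)
  qed
  also have "\<dots> = Gamma (a + b) / Gamma b * tricomi_U a (1 - b) t"
    by (simp add: tricomi_U_def set_lebesgue_integral_def)
  also have "a + b = (\<omega> l + real \<beta>) / 2" by (simp add: a_def b_def)
  finally show ?thesis by (simp only: a_def b_def)
qed

lemma laplace_log_sum: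
  assumes t: "t > 0"
  shows "Q.expectation (\<lambda>r. exp (- t * exp (log_sum r))) =
    (\<Prod>l\<in>UNIV. Gamma ((\<omega> l + real \<beta>) / 2) / Gamma (\<omega> l / 2) * tricomi_U (real \<beta> / 2) (1 - \<omega> l / 2) t)"
proof -
  have pos: "0 \<le> Gamma ((\<omega> l + real \<beta>) / 2) / Gamma (\<omega> l / 2) * tricomi_U (real \<beta> / 2) (1 - \<omega> l / 2) t" for l
  proof -
    have "tricomi_U (real \<beta> / 2) (1 - \<omega> l / 2) t \<ge> 0"
      using \<beta>_pos unfolding tricomi_U_def set_lebesgue_integral_def
      by (intro mult_nonneg_nonneg integral_nonneg_AE) auto
    then show ?thesis using \<beta>_pos \<omega>_pos[of l] by (intro mult_nonneg_nonneg divide_nonneg_nonneg Gamma_real_nonneg) auto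
  qed
  have "Q.expectation (\<lambda>r. exp (- t * exp (log_sum r))) = enn2real (\<integral>\<^sup>+r. ennreal (exp (- t * exp (log_sum r))) \<partial>Q)"
    by (intro integral_eq_nn_integral) auto
  also have "(\<integral>\<^sup>+r. ennreal (exp (- t * exp (log_sum r))) \<partial>Q) = (\<integral>\<^sup>+r. ennreal (exp (- t * abs_sum r)) \<partial>Q)"
    using AE_abs_sum_pos by (intro nn_integral_cong_AE, eventually_elim) (simp add: log_sum_def)
  also have "\<dots> = ennreal (\<Prod>l\<in>UNIV. Gamma ((\<omega> l + real \<beta>) / 2) / Gamma (\<omega> l / 2) * tricomi_U (real \<beta> / 2) (1 - \<omega> l / 2) t)"
    unfolding laplace_abs_sum[OF less_imp_le[OF t]] beta_prime_laplace_tricomi[OF t]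
    by (intro prod_ennreal pos)
  finally show ?thesis using pos by (simp add: prod_nonneg)
qed

lemma integral_formula:
  "has_bochner_integral (restrict_space lborel {0<..})
     (\<lambda>t. (exp (- t) - (\<Prod>l\<in>UNIV. Gamma ((\<omega> l + real \<beta>) / 2) / Gamma (\<omega> l / 2)
         * tricomi_U (real \<beta> / 2) (1 - \<omega> l / 2) t)) / t)
     (Q.expectation log_sum)"
proof -
  obtain p where p: "p > 0" "integrable Q (\<lambda>r. exp (p * log_sum r))" "integrable Q (\<lambda>r. exp (- p * log_sum r))"
    by (rule exp_moments_log_sum)
  have "integrable Q log_sum"
    by (rule Q.exp_moment_tangent(1)[OF _ p]) measurable
  note int = Q.expectation_eq_laplace_integral[OF this]
  have "(exp (- t) - Q.expectation (\<lambda>r. exp (- t * exp (log_sum r)))) / t =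
      (exp (- t) - (\<Prod>l\<in>UNIV. Gamma ((\<omega> l + real \<beta>) / 2) / Gamma (\<omega> l / 2)
         * tricomi_U (real \<beta> / 2) (1 - \<omega> l / 2) t)) / t"
    if "t \<in> space (restrict_space lborel {0<..})" for t
    using that by (subst laplace_log_sum) (auto simp: space_restrict_space)
  from has_bochner_integral_cong[THEN iffD1, OF refl this refl int] show ?thesis .
qed

end

section \<open>Products of independent matrices\<close>

lemma left_product_cong: "(\<And>i. i < k \<Longrightarrow> A i = B i) \<Longrightarrow> left_product A k = left_product B k"
  by (induction k) auto

lemma borel_measurable_matrix_mult [measurable (raw)]:
  fixes f g :: "'w \<Rightarrow> ('a::{euclidean_space, real_normed_div_algebra})^'n^'n"
  assumes "f \<in> borel_measurable M" "g \<in> borel_measurable M"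
  shows "(\<lambda>w. f w ** g w) \<in> borel_measurable M"
  using assms
proof (rule borel_measurable_continuous_Pair)
  show "continuous_on UNIV (\<lambda>p :: ('a^'n^'n) \<times> ('a^'n^'n). fst p ** snd p)"
    unfolding matrix_matrix_mult_def by (intro continuous_on_vec_lambda continuous_intros)
qed

lemma borel_measurable_matrix_vector_mult [measurable (raw)]:
  fixes f :: "'w \<Rightarrow> ('a::{euclidean_space, real_normed_div_algebra})^'n^'n"
  assumes "f \<in> borel_measurable M" "g \<in> borel_measurable M"
  shows "(\<lambda>w. f w *v g w) \<in> borel_measurable M"
  using assms
proof (rule borel_measurable_continuous_Pair)
  show "continuous_on UNIV (\<lambda>p :: ('a^'n^'n) \<times> ('a^'n). fst p *v snd p)"
    unfolding matrix_vector_mult_def by (intro continuous_on_vec_lambda continuous_intros)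
qed

lemma measurable_left_product:
  fixes X :: "nat \<Rightarrow> 'w \<Rightarrow> ('a::{euclidean_space, real_normed_div_algebra})^'n^'n"
  assumes "\<And>i. i < k \<Longrightarrow> X i \<in> borel_measurable M"
  shows "(\<lambda>w. left_product (\<lambda>i. X i w) k) \<in> borel_measurable M"
  using assms by (induction k) auto

text \<open>With numbering from 0, \<open>left_product _ m\<close> reads only the factors with index
  below m, and \<open>X m\<close> is the next one.\<close>

lemma (in prob_space) indep_left_product:
  fixes X :: "nat \<Rightarrow> 'a \<Rightarrow> ('b::{euclidean_space, real_normed_div_algebra})^'n^'n"
  assumes "indep_vars (\<lambda>_. borel) X UNIV"
  shows "indep_var borel (\<lambda>w. left_product (\<lambda>i. X i w) m) borel (X m)"
proof -
  let ?P = "\<lambda>I. \<Pi>\<^sub>M i\<in>I. (borel :: ('b^'n^'n) measure)"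
  have "indep_var (?P {..<m}) (\<lambda>w. restrict (\<lambda>i. X i w) {..<m}) (?P {m}) (\<lambda>w. restrict (\<lambda>i. X i w) {m})"
    by (rule indep_var_restrict[OF assms]) auto
  moreover have "(\<lambda>F. left_product F m) \<in> borel_measurable (?P {..<m})"
    using measurable_left_product[of m "\<lambda>i F. F i" "?P {..<m}"] by simp
  moreover have "(\<lambda>F. F m) \<in> borel_measurable (?P {m})"
    by simp
  ultimately have "indep_var borel ((\<lambda>F. left_product F m) \<circ> (\<lambda>w. restrict (\<lambda>i. X i w) {..<m}))
      borel ((\<lambda>F. F m) \<circ> (\<lambda>w. restrict (\<lambda>i. X i w) {m}))"
    by (rule indep_var_compose)
  moreover have "left_product (restrict (\<lambda>i. X i w) {..<m}) m = left_product (\<lambda>i. X i w) m" for w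
    by (rule left_product_cong) simp
  ultimately show ?thesis by (simp add: o_def)
qed

text \<open>The joint law of the partial product and the next factor is a product measure.
  Integrating over \<open>X m\<close> first, with the vector \<open>P w *v y\<close> frozen,
  replaces that factor by multiplication with \<open>abs_sum\<close>.\<close>

lemma nn_integral_left_product_Suc:
  fixes X :: "nat \<Rightarrow> 'w \<Rightarrow> ('a::{euclidean_space, real_normed_div_algebra})^'n^'n"
  assumes M: "prob_space M" and X: "iid_beta_II_rows M \<omega> X" and \<omega>: "\<And>l. \<omega> l > 0"
    and f [measurable]: "f \<in> borel_measurable borel"
  shows "(\<integral>\<^sup>+w. f ((norm (left_product (\<lambda>i. X i w) (Suc m) *v y))\<^sup>2) \<partial>M) =
    (\<integral>\<^sup>+w. \<integral>\<^sup>+r. f ((norm (left_product (\<lambda>i. X i w) m *v y))\<^sup>2 * abs_sum r) \<partial>beta_prime_product DIM('a) \<omega> \<partial>M)"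
proof -
  interpret M: prob_space M by fact
  interpret beta_prime_weights "DIM('a)" \<omega> by standard (use \<omega> in auto)
  have ind: "M.indep_vars (\<lambda>_. borel) X UNIV" and rows: "beta_II_rows M \<omega> (X m)"
    using X by (auto simp: iid_beta_II_rows_def)
  have Xm [measurable]: "X i \<in> borel_measurable M" for i
    using ind by (auto simp: M.indep_vars_def)
  define P where "P w = left_product (\<lambda>i. X i w) m" for w
  have P [measurable]: "P \<in> borel_measurable M"
    unfolding P_def using measurable_left_product[of m X M] by simp
  interpret Xd: prob_space "distr M borel (X m)" by (rule M.prob_space_distr) simp
  have joint: "distr M borel P \<Otimes>\<^sub>M distr M borel (X m) = distr M (borel \<Otimes>\<^sub>M borel) (\<lambda>w. (P w, X m w))"
    using M.indep_left_product[OF ind, of m] unfolding M.indep_var_distribution_eq P_def by simp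
  have step: "(\<integral>\<^sup>+A. f ((norm (A *v v))\<^sup>2) \<partial>distr M borel (X m)) = (\<integral>\<^sup>+r. f ((norm v)\<^sup>2 * abs_sum r) \<partial>Q)" for v
  proof -
    have "(\<integral>\<^sup>+A. f ((norm (A *v v))\<^sup>2) \<partial>distr M borel (X m)) = (\<integral>\<^sup>+u. f u \<partial>distr M borel (\<lambda>w. (norm (X m w *v v))\<^sup>2))"
      by (simp add: nn_integral_distr)
    also have "\<dots> = (\<integral>\<^sup>+r. f ((norm v)\<^sup>2 * abs_sum r) \<partial>Q)"
      unfolding distr_norm_matrix_vector_mult[OF M rows \<omega> Xm] by (simp add: nn_integral_distr)
    finally show ?thesis .
  qed
  have "(\<integral>\<^sup>+w. f ((norm (left_product (\<lambda>i. X i w) (Suc m) *v y))\<^sup>2) \<partial>M) = (\<integral>\<^sup>+w. f ((norm (X m w *v (P w *v y)))\<^sup>2) \<partial>M)"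
    by (simp add: P_def matrix_vector_mul_assoc)
  also have "\<dots> = (\<integral>\<^sup>+p. f ((norm (snd p *v (fst p *v y)))\<^sup>2) \<partial>distr M (borel \<Otimes>\<^sub>M borel) (\<lambda>w. (P w, X m w)))"
    by (simp add: nn_integral_distr)
  also have "\<dots> = (\<integral>\<^sup>+B. \<integral>\<^sup>+A. f ((norm (A *v (B *v y)))\<^sup>2) \<partial>distr M borel (X m) \<partial>distr M borel P)"
    unfolding joint[symmetric] by (subst Xd.nn_integral_fst[symmetric]) simp_all
  also have "\<dots> = (\<integral>\<^sup>+w. \<integral>\<^sup>+r. f ((norm (P w *v y))\<^sup>2 * abs_sum r) \<partial>Q \<partial>M)"
    unfolding step by (simp add: nn_integral_distr)
  finally show ?thesis by (simp add: P_def)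
qed

section \<open>The Lyapunov exponent\<close>

lemma AE_growth_rate_tendsto:
  fixes X :: "nat \<Rightarrow> 'w \<Rightarrow> ('a::{euclidean_space, real_normed_div_algebra})^'n^'n"
  assumes M: "prob_space M" and X: "iid_beta_II_rows M \<omega> X" and \<omega>: "\<And>l. \<omega> l > 0" and y: "y \<noteq> 0"
    and \<mu>: "2 * \<mu> = integral\<^sup>L (beta_prime_product DIM('a) \<omega>) (\<lambda>r. ln (abs_sum r))"
  shows "AE w in M. growth_rate (\<lambda>i. X i w) y \<longlonglongrightarrow> ereal \<mu>"
proof -
  interpret M: prob_space M by fact
  interpret beta_prime_weights "DIM('a)" \<omega> by standard (use \<omega> in auto)
  define V where "V m w = left_product (\<lambda>i. X i w) m *v y" for m w
  define Z where "Z m w = (norm (V m w))\<^sup>2" for m w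
  have Xm: "X i \<in> borel_measurable M" for i
    using X by (auto simp: iid_beta_II_rows_def M.indep_vars_def)
  have V [measurable]: "V m \<in> borel_measurable M" for m
    unfolding V_def using measurable_left_product[of m X M] Xm by simp
  have Z [measurable]: "Z m \<in> borel_measurable M" for m
    unfolding Z_def by measurable
  have Z0: "Z 0 w = (norm y)\<^sup>2" for w
    by (simp add: Z_def V_def)
  have step: "(\<integral>\<^sup>+w. f (Z (Suc m) w) \<partial>M) = (\<integral>\<^sup>+w. \<integral>\<^sup>+r. f (Z m w * abs_sum r) \<partial>Q \<partial>M)"
    if "f \<in> borel_measurable borel" for f :: "real \<Rightarrow> ennreal" and m
    unfolding Z_def V_def by (rule nn_integral_left_product_Suc[OF M X \<omega> that])
  \<comment> \<open>Finite moments of negative order cannot exclude zeros, because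
    \<open>0 powr s = 0\<close> for every s; the one-step identity with an indicator function
    does.\<close>
  have nz: "AE w in M. Z m w \<noteq> 0" for m
  proof (induction m)
    case (Suc m)
    have "(\<integral>\<^sup>+w. indicator {0} (Z (Suc m) w) \<partial>M) = (\<integral>\<^sup>+w. \<integral>\<^sup>+r. indicator {0} (Z m w * abs_sum r) \<partial>Q \<partial>M)"
      by (rule step) measurable
    also have "\<dots> = (\<integral>\<^sup>+w. 0 \<partial>M)"
    proof (rule nn_integral_cong_AE)
      show "AE w in M. (\<integral>\<^sup>+r. indicator {0} (Z m w * abs_sum r) \<partial>Q) = 0"
        using Suc.IH
      proof eventually_elim
        case (elim w)
        have "AE r in Q. indicator {0} (Z m w * abs_sum r) = (0::ennreal)"
          using AE_abs_sum_pos by eventually_elim (use elim in auto)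
        then show ?case by (subst nn_integral_0_iff_AE) auto
      qed
    qed
    finally have "(\<integral>\<^sup>+w. indicator {0} (Z (Suc m) w) \<partial>M) = 0" by simp
    then have "AE w in M. indicator {0} (Z (Suc m) w) = (0::ennreal)"
      by (subst (asm) nn_integral_0_iff_AE) auto
    then show ?case by eventually_elim (auto simp: indicator_def split: if_splits)
  qed (simp add: Z0 y)
  then have AE_nz: "AE w in M. \<forall>m. Z m w \<noteq> 0"
    by (simp add: AE_all_countable)
  have pos: "AE w in M. \<forall>m. Z m w > 0"
    using AE_nz by eventually_elim (simp add: Z_def)
  obtain p where p: "p > 0" "integrable Q (\<lambda>r. exp (p * log_sum r))" "integrable Q (\<lambda>r. exp (- p * log_sum r))"
    by (rule exp_moments_log_sum)
  have mean: "(\<integral>\<^sup>+w. ennreal (Z m w powr s) \<partial>M) = ennreal (Q.expectation (\<lambda>r. exp (s * log_sum r)) ^ m * (norm y)\<^sup>2 powr s)"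
    if s: "\<bar>s\<bar> \<le> p" for s m
  proof (induction m)
    case (Suc m)
    let ?c = "Q.expectation (\<lambda>r. exp (s * log_sum r))"
    have c: "?c \<ge> 0" by (intro integral_nonneg_AE) auto
    have "integrable Q (\<lambda>r. exp (s * log_sum r))"
      by (rule Q.exp_moments_imp_integrable[OF measurable_log_sum p s])
    then have "(\<integral>\<^sup>+r. ennreal (exp (s * log_sum r)) \<partial>Q) = ennreal ?c"
      by (intro nn_integral_eq_integral) auto
    also have "(\<integral>\<^sup>+r. ennreal (exp (s * log_sum r)) \<partial>Q) = (\<integral>\<^sup>+r. ennreal (abs_sum r powr s) \<partial>Q)"
      using AE_exp_log_sum[of s] by (intro nn_integral_cong_AE) auto
    finally have mom: "(\<integral>\<^sup>+r. ennreal (abs_sum r powr s) \<partial>Q) = ennreal ?c" .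
    have "(\<integral>\<^sup>+w. ennreal (Z (Suc m) w powr s) \<partial>M) = (\<integral>\<^sup>+w. \<integral>\<^sup>+r. ennreal ((Z m w * abs_sum r) powr s) \<partial>Q \<partial>M)"
      by (rule step) measurable
    also have "\<dots> = (\<integral>\<^sup>+w. ennreal (Z m w powr s) * ennreal ?c \<partial>M)"
    proof (intro nn_integral_cong)
      fix w
      have "(\<integral>\<^sup>+r. ennreal ((Z m w * abs_sum r) powr s) \<partial>Q) = (\<integral>\<^sup>+r. ennreal (Z m w powr s) * ennreal (abs_sum r powr s) \<partial>Q)"
        by (intro nn_integral_cong) (simp add: powr_mult Z_def abs_sum_def sum_nonneg ennreal_mult[symmetric])
      then show "(\<integral>\<^sup>+r. ennreal ((Z m w * abs_sum r) powr s) \<partial>Q) = ennreal (Z m w powr s) * ennreal ?c"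
        by (simp add: nn_integral_cmult mom)
    qed
    also have "\<dots> = (\<integral>\<^sup>+w. ennreal (Z m w powr s) \<partial>M) * ennreal ?c"
      by (rule nn_integral_multc) measurable
    also have "\<dots> = ennreal (?c ^ Suc m * (norm y)\<^sup>2 powr s)"
      unfolding Suc.IH using c by (simp add: ennreal_mult[symmetric] mult_ac)
    finally show ?case .
  qed (simp add: Z0 M.emeasure_space_1)
  have "AE w in M. (\<lambda>m. ln (Z m w) / real m) \<longlonglongrightarrow> Q.expectation log_sum"
    by (rule M.AE_log_growth[OF Z pos Q.prob_space_axioms measurable_log_sum p _ mean]) (simp_all add: y)
  with AE_nz show ?thesis
  proof eventually_elim
    case (elim w)
    \<comment> \<open>The factor 1/2 appears because Z is the squared norm.\<close>
    have "(\<lambda>m. ln (Z m w) / real m / 2) \<longlonglongrightarrow> Q.expectation log_sum / 2"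
      using elim(2) by (rule tendsto_divide) simp_all
    also have "Q.expectation log_sum / 2 = \<mu>"
      using \<mu> by (simp add: log_sum_def[abs_def])
    finally have "(\<lambda>m. ereal (ln (Z m w) / real m / 2)) \<longlonglongrightarrow> ereal \<mu>"
      by (rule tendsto_ereal)
    \<comment> \<open>The two sides may differ at m = 0, where real and extended real division by 0
      follow different conventions.\<close>
    moreover have "\<forall>\<^sub>F m in sequentially. ereal (ln (Z m w) / real m / 2) = growth_rate (\<lambda>i. X i w) y m"
      using eventually_gt_at_top[of 0]
    proof eventually_elim
      case (elim m)
      have "V m w \<noteq> 0" using \<open>\<forall>m. Z m w \<noteq> 0\<close> by (auto simp: Z_def)
      then show ?case
        using elim by (simp add: growth_rate_def log_norm_def V_def[symmetric] Z_def ln_realpow)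
    qed
    ultimately show ?case by (rule Lim_transform_eventually)
  qed
qed

text \<open>\<open>A *v y\<close> is the sum of the columns of A with the entries of y multiplied on
  the right, and the norm is multiplicative on each entry.\<close>

lemma norm_matrix_vector_mult_le:
  fixes A :: "'a::real_normed_div_algebra^'n^'n"
  shows "norm (A *v y) \<le> (\<Sum>j\<in>UNIV. norm (A *v axis j 1) * norm (y $ j))"
proof -
  have "(A *v axis j 1) $ i = A $ i $ j" for i j
    by (simp add: matrix_vector_mult_def axis_def if_distrib[of "\<lambda>x. _ * x"] cong: if_cong)
  then have eq: "A *v y = (\<Sum>j\<in>UNIV. \<chi> i. (A *v axis j 1) $ i * y $ j)"
    by (simp add: vec_eq_iff matrix_vector_mult_def)
  have "norm (\<chi> i. (A *v axis j 1) $ i * y $ j) = norm (A *v axis j 1) * norm (y $ j)" for j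
    by (simp add: norm_vec_def norm_mult L2_set_left_distrib)
  then show ?thesis
    unfolding eq by (intro order_trans[OF norm_sum]) simp
qed

text \<open>A statement about one fixed sequence of matrices: every \<open>P\<^sub>m y\<close> is
  dominated by the finitely many images of the basis vectors, up to a constant C whose logarithm
  vanishes after division by m.\<close>

lemma growth_rate_limit_le:
  fixes A :: "nat \<Rightarrow> ('a::real_normed_div_algebra)^'n^'n"
  assumes basis: "\<And>j. growth_rate A (axis j 1) \<longlonglongrightarrow> ereal \<mu>" and L: "growth_rate A y \<longlonglongrightarrow> L"
  shows "L \<le> ereal \<mu>"
proof (rule ereal_le_epsilon2)
  fix e :: real assume e: "e > 0"
  \<comment> \<open>Adding 1 keeps C positive for every y, so \<open>ln C\<close> is
    meaningful.\<close>
  define C where "C = (\<Sum>j\<in>UNIV. norm (y $ j)) + 1"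
  have C: "C > 0" unfolding C_def by (intro add_nonneg_pos sum_nonneg) auto
  have basis_le: "\<forall>\<^sub>F m in sequentially. norm (left_product A m *v axis j 1) \<le> exp ((\<mu> + e) * real m)" for j
  proof -
    have "\<forall>\<^sub>F m in sequentially. growth_rate A (axis j 1) m < ereal (\<mu> + e)"
      using basis[of j] e by (intro order_tendstoD) auto
    then show ?thesis using eventually_gt_at_top[of 0]
    proof eventually_elim
      case (elim m)
      show ?case
      proof (cases "left_product A m *v axis j 1 = 0")
        case False
        then have "ln (norm (left_product A m *v axis j 1)) \<le> (\<mu> + e) * real m"
          using elim by (simp add: growth_rate_def log_norm_def field_simps)
        then have "exp (ln (norm (left_product A m *v axis j 1))) \<le> exp ((\<mu> + e) * real m)" by simp
        then show ?thesis using False by simp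
      qed simp
    qed
  qed
  then have all_basis_le: "\<forall>\<^sub>F m in sequentially. \<forall>j. norm (left_product A m *v axis j 1) \<le> exp ((\<mu> + e) * real m)"
    by (intro eventually_all_finite)
  have "\<forall>\<^sub>F m in sequentially. growth_rate A y m \<le> ereal (ln C / real m + (\<mu> + e))"
    using all_basis_le eventually_gt_at_top[of 0]
  proof eventually_elim
    case (elim m)
    have "norm (left_product A m *v y) \<le> (\<Sum>j\<in>UNIV. norm (left_product A m *v axis j 1) * norm (y $ j))"
      by (rule norm_matrix_vector_mult_le)
    also have "\<dots> \<le> (\<Sum>j\<in>UNIV. exp ((\<mu> + e) * real m) * norm (y $ j))"
      using elim by (intro sum_mono mult_right_mono) auto
    also have "\<dots> \<le> C * exp ((\<mu> + e) * real m)"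
      unfolding C_def sum_distrib_left[symmetric] by (simp add: distrib_right mult.commute)
    finally have le: "norm (left_product A m *v y) \<le> C * exp ((\<mu> + e) * real m)" .
    show ?case
    proof (cases "left_product A m *v y = 0")
      case False
      then have "ln (norm (left_product A m *v y)) \<le> ln (C * exp ((\<mu> + e) * real m))"
        using le by (intro ln_mono) auto
      also have "\<dots> = ln C + (\<mu> + e) * real m"
        using C by (simp add: ln_mult)
      finally show ?thesis
        using False elim by (simp add: growth_rate_def log_norm_def field_simps)
    qed (use elim in \<open>simp add: growth_rate_def log_norm_def\<close>)
  qed
  moreover have "(\<lambda>m. ereal (ln C / real m + (\<mu> + e))) \<longlonglongrightarrow> ereal (0 + (\<mu> + e))"
    by (intro tendsto_ereal tendsto_add tendsto_const lim_const_over_n)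
  ultimately have "L \<le> ereal (0 + (\<mu> + e))"
    by (intro tendsto_le[OF _ _ L]) auto
  then show "L \<le> ereal \<mu> + ereal e" by simp
qed

lemma is_largest_lyapunov_exponent_beta_II:
  fixes X :: "nat \<Rightarrow> 'w \<Rightarrow> ('a::{euclidean_space, real_normed_div_algebra})^'n^'n"
  assumes M: "prob_space M" and X: "iid_beta_II_rows M \<omega> X" and \<omega>: "\<And>l. \<omega> l > 0"
    and \<mu>: "2 * \<mu> = integral\<^sup>L (beta_prime_product DIM('a) \<omega>) (\<lambda>r. ln (abs_sum r))"
  shows "is_largest_lyapunov_exponent M X \<mu>"
proof -
  note growth = AE_growth_rate_tendsto[OF M X \<omega> _ \<mu>]
  have "AE w in M. convergent (growth_rate (\<lambda>i. X i w) y)" if "y \<noteq> 0" for y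
    using growth[OF that] by eventually_elim (auto simp: convergent_def)
  moreover have "AE w in M. Sup {L. \<exists>y. y \<noteq> 0 \<and> growth_rate (\<lambda>i. X i w) y \<longlonglongrightarrow> L} = ereal \<mu>"
  proof -
    \<comment> \<open>The null set of \<open>growth\<close> depends on the vector, and there are
      uncountably many vectors; only finitely many null sets are united here.\<close>
    have "AE w in M. \<forall>j. growth_rate (\<lambda>i. X i w) (axis j 1) \<longlonglongrightarrow> ereal \<mu>"
      using growth by (simp add: AE_all_countable axis_eq_0_iff)
    then show ?thesis
    proof eventually_elim
      case (elim w)
      show ?case
      proof (rule antisym)
        show "Sup {L. \<exists>y. y \<noteq> 0 \<and> growth_rate (\<lambda>i. X i w) y \<longlonglongrightarrow> L} \<le> ereal \<mu>"
          using elim by (auto intro!: Sup_least growth_rate_limit_le)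
        show "ereal \<mu> \<le> Sup {L. \<exists>y. y \<noteq> 0 \<and> growth_rate (\<lambda>i. X i w) y \<longlonglongrightarrow> L}"
          using elim by (intro Sup_upper) (auto intro!: exI[of _ "axis undefined 1"] simp: axis_eq_0_iff)
      qed
    qed
  qed
  ultimately show ?thesis by (simp add: is_largest_lyapunov_exponent_def)
qed

theorem proposition12:
  fixes M :: "'w measure" and \<beta> :: nat and \<omega> :: "'n::finite \<Rightarrow> real"
  assumes "prob_space M" and "\<beta> \<in> {1, 2, 4}" and "\<And>l. \<omega> l > 0"
  shows "\<exists>\<mu>\<^sub>1.
     has_bochner_integral (restrict_space lborel {0<..})
       (\<lambda>t. (exp (- t) -
             (\<Prod>l\<in>UNIV. Gamma ((\<omega> l + real \<beta>) / 2) / Gamma (\<omega> l / 2)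
                        * tricomi_U (real \<beta> / 2) (1 - \<omega> l / 2) t)) / t)
       (2 * \<mu>\<^sub>1) \<and>
     (\<beta> = 1 \<longrightarrow> (\<forall>X :: nat \<Rightarrow> 'w \<Rightarrow> real^'n^'n.
        iid_beta_II_rows M \<omega> X \<longrightarrow> is_largest_lyapunov_exponent M X \<mu>\<^sub>1)) \<and>
     (\<beta> = 2 \<longrightarrow> (\<forall>X :: nat \<Rightarrow> 'w \<Rightarrow> complex^'n^'n.
        iid_beta_II_rows M \<omega> X \<longrightarrow> is_largest_lyapunov_exponent M X \<mu>\<^sub>1)) \<and>
     (\<beta> = 4 \<longrightarrow> (\<forall>X :: nat \<Rightarrow> 'w \<Rightarrow> quat^'n^'n.
        iid_beta_II_rows M \<omega> X \<longrightarrow> is_largest_lyapunov_exponent M X \<mu>\<^sub>1))"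
proof -
  interpret beta_prime_weights \<beta> \<omega> by standard (use assms in auto)
  \<comment> \<open>Defined on the reference space from \<beta> and \<omega> alone, so one number
    serves every sequence X.\<close>
  define \<mu>\<^sub>1 where "\<mu>\<^sub>1 = integral\<^sup>L Q log_sum / 2"
  have \<mu>: "2 * \<mu>\<^sub>1 = integral\<^sup>L (beta_prime_product \<beta> \<omega>) (\<lambda>r. ln (abs_sum r))"
    by (simp add: \<mu>\<^sub>1_def log_sum_def[abs_def])
  show ?thesis
  proof (intro exI[of _ \<mu>\<^sub>1] conjI impI allI)
    show "has_bochner_integral (restrict_space lborel {0<..})
       (\<lambda>t. (exp (- t) - (\<Prod>l\<in>UNIV. Gamma ((\<omega> l + real \<beta>) / 2) / Gamma (\<omega> l / 2)
                        * tricomi_U (real \<beta> / 2) (1 - \<omega> l / 2) t)) / t) (2 * \<mu>\<^sub>1)"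
      using integral_formula by (simp add: \<mu>\<^sub>1_def)
  qed (use assms \<mu> in \<open>auto intro!: is_largest_lyapunov_exponent_beta_II\<close>)
qed

end
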